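(* Let $p$ be an odd prime, let $n,k$ be positive integers, and let $f\in\mathcal{GB}_n^{p^k}$ be a gbent function given as $f(\mathbf{x})=\sum_{i=0}^{k-1}p^ia_i(\mathbf{x})$ with functions $a_i:\mathbb{Z}_p^n\to\mathbb{Z}_p$. Then the generalized Gray image $G(f)\in\mathcal{GB}_{n+k-1}^{p}$ is a $(k-1)$-plateaued function, in the sense that for every $(\mathbf{u},\mathbf{z})\in\mathbb{Z}_p^n\times\mathbb{Z}_p^{k-1}$ there is $a\in\mathbb{Z}_p$ such that $$\mathcal{W}_{G(f)}(\mathbf{u},\mathbf{z})\in\begin{cases}\{0,\ \zeta_p^{a}p^{\frac{k-1}{2}},\ -\zeta_p^{a}p^{\frac{k-1}{2}}\} & \text{if } n \text{ is even, or } n \text{ is odd and } p\equiv 1 \pmod 4,\\ \{0,\ \sqrt{-1}\,\zeta_p^{a}p^{\frac{k-1}{2}},\ -\sqrt{-1}\,\zeta_p^{a}p^{\frac{k-1}{2}}\} & \text{if } n \text{ is odd and } p\equiv 3 \pmod 4.\end{cases}$$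
   Context: $\mathbb{Z}_m$ is the ring of integers modulo $m$, and $\zeta_m=e^{2\pi\sqrt{-1}/m}$. $\mathcal{GB}_n^{p^r}$ is the set of all functions $\mathbb{Z}_p^n\to\mathbb{Z}_{p^r}$. For $F\in\mathcal{GB}_n^{p^r}$ the generalized Walsh-Hadamard transform is $\mathcal{H}_F(\mathbf{u})=p^{-n/2}\sum_{\mathbf{x}\in\mathbb{Z}_p^n}\zeta_p^{-\mathbf{u}\cdot\mathbf{x}}\zeta_{p^r}^{F(\mathbf{x})}$; $F$ is gbent if $|\mathcal{H}_F(\mathbf{u})|=1$ for all $\mathbf{u}\in\mathbb{Z}_p^n$. For a $p$-ary function $F:\mathbb{Z}_p^m\to\mathbb{Z}_p$, $\mathcal{W}_F(\mathbf{w})=p^{-m/2}\sum_{\mathbf{x}\in\mathbb{Z}_p^m}\zeta_p^{F(\mathbf{x})-\mathbf{w}\cdot\mathbf{x}}$. In $f=\sum p^ia_i$, elements of $\mathbb{Z}_p$ are identified with their representatives in $\{0,\dots,p-1\}$. The generalized Gray map $G:\mathcal{GB}_n^{p^k}\to\mathcal{GB}_{n+k-1}^{p}$ sends $f=\sum_{i=0}^{k-1}p^ia_i$ to the function $G(f):\mathbb{Z}_p^n\times\mathbb{Z}_p^{k-1}\to\mathbb{Z}_p$, $(\mathbf{x},y_0,\dots,y_{k-2})\mapsto a_{k-1}(\mathbf{x})+\sum_{i=0}^{k-2}a_i(\mathbf{x})y_i$. *)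

theory Defs
  imports Complex_Main "HOL-Library.FuncSet" "HOL-Number_Theory.Cong"
begin

text \<open>
  Residue classes modulo \<open>m\<close> are identified with their representatives in
  \<open>{0,...,m-1}\<close>, so \<open>Zmod m\<close> is the carrier of \<open>residue_ring (int m)\<close>. Vectors over
  \<open>Zmod p\<close> are lists, so that concatenation identifies
  \<open>Zvec p n \<times> Zvec p l\<close> with \<open>Zvec p (n + l)\<close>.
\<close>

definition Zmod :: "nat \<Rightarrow> int set" where
  "Zmod m = {0..<int m}"

definition Zvec :: "nat \<Rightarrow> nat \<Rightarrow> int list set" where
  "Zvec p n = {x. length x = n \<and> set x \<subseteq> Zmod p}"

text \<open>Functions from \<open>Zvec p n\<close> to \<open>Zmod (p ^ r)\<close>; values outside \<open>Zvec p n\<close> are irrelevant.\<close>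

definition GB :: "nat \<Rightarrow> nat \<Rightarrow> nat \<Rightarrow> (int list \<Rightarrow> int) set" where
  "GB p r n = Zvec p n \<rightarrow> Zmod (p ^ r)"

definition zeta :: "nat \<Rightarrow> complex" where
  "zeta m = exp (2 * of_real pi * \<i> / of_nat m)"

text \<open>The dot product is not reduced modulo \<open>p\<close>: it is only used as an exponent of \<open>zeta p\<close>.\<close>

definition dot :: "int list \<Rightarrow> int list \<Rightarrow> int" where
  "dot u x = (\<Sum>i<length x. u ! i * x ! i)"

definition gen_walsh :: "nat \<Rightarrow> nat \<Rightarrow> nat \<Rightarrow> (int list \<Rightarrow> int) \<Rightarrow> int list \<Rightarrow> complex" where
  "gen_walsh p r n F u =
     of_real (real p powr (- real n / 2)) *
     (\<Sum>x\<in>Zvec p n. zeta p powi (- dot u x) * zeta (p ^ r) powi (F x))"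

definition gbent :: "nat \<Rightarrow> nat \<Rightarrow> nat \<Rightarrow> (int list \<Rightarrow> int) \<Rightarrow> bool" where
  "gbent p r n F \<longleftrightarrow> F \<in> GB p r n \<and> (\<forall>u\<in>Zvec p n. norm (gen_walsh p r n F u) = 1)"

definition walsh :: "nat \<Rightarrow> nat \<Rightarrow> (int list \<Rightarrow> int) \<Rightarrow> int list \<Rightarrow> complex" where
  "walsh p m F w =
     of_real (real p powr (- real m / 2)) *
     (\<Sum>x\<in>Zvec p m. zeta p powi (F x - dot w x))"

text \<open>
  The \<open>i\<close>-th base-\<open>p\<close> digit of \<open>f\<close>, that is, the function \<open>a\<^sub>i\<close> in the unique expansion
  \<open>f = (\<Sum>i<k. p ^ i * a\<^sub>i)\<close>; see \<open>digit_fun_unique\<close> below.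
\<close>

definition digit_fun :: "nat \<Rightarrow> (int list \<Rightarrow> int) \<Rightarrow> nat \<Rightarrow> int list \<Rightarrow> int" where
  "digit_fun p f i x = f x div int p ^ i mod int p"

text \<open>
  An element of \<open>Zvec p (n + k - 1)\<close> is read as \<open>x @ y\<close> with \<open>x\<close> of length \<open>n\<close> and
  \<open>y\<close> of length \<open>k - 1\<close>; see \<open>gray_map_append\<close> below.
\<close>

definition gray_map :: "nat \<Rightarrow> nat \<Rightarrow> nat \<Rightarrow> (int list \<Rightarrow> int) \<Rightarrow> int list \<Rightarrow> int" where
  "gray_map p k n f v =
     (let x = take n v; y = drop n v in
      (digit_fun p f (k - 1) x + (\<Sum>i<k - 1. digit_fun p f i x * y ! i)) mod int p)"

lemma digit_unique:
  fixes p :: int and c :: "nat \<Rightarrow> int"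
  assumes "p > 0" "\<And>i. i < k \<Longrightarrow> c i \<in> {0..<p}" "j < k"
  shows "(\<Sum>i<k. p ^ i * c i) div p ^ j mod p = c j"
  using assms(2,3)
proof (induction k arbitrary: c j)
  case (Suc k)
  have split: "(\<Sum>i<Suc k. p ^ i * c i) = c 0 + p * (\<Sum>i<k. p ^ i * c (Suc i))"
    by (simp add: sum.lessThan_Suc_shift sum_distrib_left mult.assoc del: sum.lessThan_Suc)
  have c0: "0 \<le> c 0" "c 0 < p"
    using Suc.prems(1)[of 0] by auto
  show ?case
  proof (cases j)
    case 0
    then show ?thesis using c0 unfolding split by simp
  next
    case (Suc j')
    have "(c 0 + p * (\<Sum>i<k. p ^ i * c (Suc i))) div p = (\<Sum>i<k. p ^ i * c (Suc i))"
      using c0 by simp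
    moreover have "(\<Sum>i<k. p ^ i * c (Suc i)) div p ^ j' mod p = c (Suc j')"
      using Suc Suc.prems by (intro Suc.IH) auto
    ultimately show ?thesis
      using assms(1) unfolding split Suc by (simp add: zdiv_zmult2_eq)
  qed
qed simp

lemma digit_fun_unique:
  assumes "p > 0" "\<And>i. i < k \<Longrightarrow> a i x \<in> Zmod p"
    and "f x = (\<Sum>i<k. int p ^ i * a i x)" "i < k"
  shows "digit_fun p f i x = a i x"
  using digit_unique[of "int p" k "\<lambda>i. a i x" i] assms
  by (simp add: digit_fun_def Zmod_def)

lemma gray_map_append:
  assumes "p > 0" "k > 0" "\<And>i. i < k \<Longrightarrow> a i x \<in> Zmod p"
    and "f x = (\<Sum>i<k. int p ^ i * a i x)" "length x = n"
  shows "gray_map p k n f (x @ y) = (a (k - 1) x + (\<Sum>i<k - 1. a i x * y ! i)) mod int p"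
proof -
  have "digit_fun p f i x = a i x" if "i < k" for i
    by (rule digit_fun_unique[where k = k]) (use assms that in auto)
  then show ?thesis
    using assms(2,5) by (simp add: gray_map_def)
qed

end

theory Submission
  imports Defs "HOL-Computational_Algebra.Polynomial" "HOL-Number_Theory.Totient"
begin

text \<open>
  Put \<open>q = p\<^bsup>k-1\<^esup>\<close>, let \<open>w\<close> be \<open>zeta (p * q)\<close>, so that \<open>w\<^bsup>q\<^esup> = zeta p\<close>, and fix \<open>u\<close>. For \<open>j < q\<close> let
  \<open>T j\<close> be the sum of \<open>zeta p\<close> to the power \<open>a\<^bsub>k-1\<^esub>(x) - u \<cdot> x\<close> over all \<open>x\<close> for which the lower digits
  of \<open>f x\<close> form the number \<open>j\<close>. Up to the normalising factor, the generalized transform of \<open>f\<close> at \<open>u\<close>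
  is \<open>\<alpha> = \<Sum>\<^sub>j w\<^bsup>j\<^esup> T j\<close> (\<open>gen_walsh_blocks\<close>). In the transform of the Gray image at \<open>(u, z)\<close> the sum
  over the new variables is a character sum that leaves \<open>p\<^bsup>k-1\<^esup> T j\<close> for the one \<open>j\<close> with digits \<open>z\<close>
  (\<open>walsh_gray_map\<close>). So the theorem is a statement about cyclotomic integers (\<open>single_block\<close>): if
  \<open>\<alpha>\<close> has squared absolute value \<open>p\<^bsup>n\<^esup>\<close>, then only one block \<open>T j\<close> is nonzero, and it is
  \<open>\<plusminus> zeta p ^ s * sqrt_pstar p ^ n\<close>. Here \<open>sqrt_pstar p\<close> is \<open>\<surd>p\<close> or \<open>\<i>\<surd>p\<close> according to \<open>p\<close>
  modulo 4, which accounts for the two cases.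

  The proof of this statement avoids ideals and Galois groups. By Eisenstein's criterion the
  cyclotomic polynomial \<open>\<Sum>\<^bsub>s<p\<^esub> X\<^bsup>qs\<^esup>\<close> divides every integer polynomial that vanishes at \<open>w\<close>
  (\<open>cyclo_dvd\<close>). It follows that an integer relation among the powers of \<open>w\<close> has coefficients that are
  constant on the residue classes modulo \<open>q\<close> (\<open>coeffs_periodic\<close>), and that evaluation of polynomials
  at 1 modulo \<open>p\<close> is well defined on \<open>\<int>[w]\<close> (\<open>p_dvd_poly_1\<close>).

  The second consequence makes \<open>1 - w\<close> a prime element. Since \<open>p\<close> is the product of the \<open>1 - w\<^bsup>t\<^esup>\<close>
  with \<open>t\<close> prime to \<open>p\<close>, which come in conjugate pairs, the product over one half of these \<open>t\<close> has
  squared absolute value \<open>p\<close>, and it is \<open>sqrt_pstar p\<close> up to sign and a power of \<open>w\<close>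
  (\<open>half_prod_eq\<close>). Its factors can be split off from \<open>\<alpha>\<close> one after the other, until an element
  \<open>\<gamma>\<close> of \<open>\<int>[w]\<close> with absolute value 1 remains (\<open>split_off_half_prod_power\<close>).

  The first consequence yields the trace of \<open>\<gamma> * cnj \<gamma> = 1\<close>: the variances of the coefficients of
  \<open>\<gamma>\<close> along the classes modulo \<open>q\<close> add up to \<open>p - 1\<close>. This is the least value that a
  nonconstant class can have, and it is attained only by a class with a single exceptional
  coefficient, off by \<open>\<plusminus>1\<close>. Hence \<open>\<gamma>\<close> is \<open>\<plusminus>\<close> a power of \<open>w\<close>
  (\<open>norm_one_imp_root_of_unity\<close>). Therefore \<open>\<alpha>\<close> is \<open>\<plusminus> w\<^bsup>r\<^esup> * sqrt_pstar p ^ n\<close>. As \<open>sqrt_pstar p\<close> is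
  already in \<open>\<int>[zeta p]\<close>, and the \<open>w\<^bsup>j\<^esup>\<close> with \<open>j < q\<close> are independent over this ring, comparison with
  \<open>\<Sum>\<^sub>j w\<^bsup>j\<^esup> T j\<close> finishes the argument.
\<close>

section \<open>Integer polynomials at complex points\<close>

definition ipoly :: "int poly \<Rightarrow> complex \<Rightarrow> complex" where
  "ipoly f x = poly (map_poly of_int f) x"

lemma ipoly_0 [simp]: "ipoly 0 x = 0"
  by (simp add: ipoly_def)

lemma ipoly_pCons [simp]: "ipoly (pCons a f) x = of_int a + x * ipoly f x"
  by (simp add: ipoly_def map_poly_pCons)

lemma ipoly_1 [simp]: "ipoly 1 x = 1"
  by (simp add: ipoly_def)

lemma ipoly_monom [simp]: "ipoly (monom c n) x = of_int c * x ^ n"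
  by (simp add: ipoly_def map_poly_monom poly_monom)

lemma ipoly_add [simp]: "ipoly (f + g) x = ipoly f x + ipoly g x"
proof -
  have "map_poly of_int (f + g) = map_poly of_int f + (map_poly of_int g :: complex poly)"
    by (intro poly_eqI) (simp add: coeff_map_poly)
  then show ?thesis
    by (simp add: ipoly_def)
qed

lemma ipoly_smult [simp]: "ipoly (smult a f) x = of_int a * ipoly f x"
  by (induction f) (simp_all add: algebra_simps)

lemma ipoly_minus [simp]: "ipoly (- f) x = - ipoly f x"
  using ipoly_smult[of "-1" f x] by simp

lemma ipoly_diff [simp]: "ipoly (f - g) x = ipoly f x - ipoly g x"
  using ipoly_add[of f "- g" x] by simp

lemma ipoly_mult [simp]: "ipoly (f * g) x = ipoly f x * ipoly g x"
  by (induction f) (simp_all add: algebra_simps)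

lemma ipoly_power [simp]: "ipoly (f ^ n) x = ipoly f x ^ n"
  by (induction n) simp_all

lemma ipoly_sum [simp]: "ipoly (sum f A) x = (\<Sum>a\<in>A. ipoly (f a) x)"
  by (induction A rule: infinite_finite_induct) simp_all

lemma ipoly_pcompose [simp]: "ipoly (pcompose f g) x = ipoly f (ipoly g x)"
  by (induction f) (simp_all add: pcompose_pCons)

lemma cnj_ipoly: "cnj (ipoly f x) = ipoly f (cnj x)"
  by (induction f) simp_all

section \<open>The shifted cyclotomic polynomial and Eisenstein's criterion\<close>

text \<open>
  Let \<open>i\<close> be least with \<open>P\<close> not dividing the \<open>i\<close>-th coefficient of \<open>F\<close>. In the \<open>i\<close>-th
  coefficient of \<open>F * G\<close> exactly one summand is prime to \<open>P\<close>, so \<open>i\<close> is at least the degree of the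
  product. But \<open>i\<close> is at most the degree of \<open>F\<close>.
\<close>

lemma eisenstein_aux:
  fixes F G :: "int poly"
  assumes "prime P" and lead: "\<not> P dvd lead_coeff (F * G)"
    and low: "\<And>i. i < degree (F * G) \<Longrightarrow> P dvd coeff (F * G) i"
    and G0: "\<not> P dvd coeff G 0"
  shows "degree G = 0"
proof -
  have nz: "F \<noteq> 0" "G \<noteq> 0"
    using lead by auto
  have "\<not> P dvd coeff F (degree F)"
    using lead by (auto simp: lead_coeff_mult)
  define i where "i = (LEAST i. \<not> P dvd coeff F i)"
  have i: "\<not> P dvd coeff F i" "i \<le> degree F" "\<And>j. j < i \<Longrightarrow> P dvd coeff F j"
    unfolding i_def using LeastI[of "\<lambda>i. \<not> P dvd coeff F i", OF \<open>\<not> P dvd coeff F (degree F)\<close>]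
      Least_le[of "\<lambda>i. \<not> P dvd coeff F i", OF \<open>\<not> P dvd coeff F (degree F)\<close>]
    by (auto dest: not_less_Least)
  have "coeff (F * G) i = (\<Sum>j\<le>i. coeff F j * coeff G (i - j))"
    by (rule coeff_mult)
  also have "\<dots> = (\<Sum>j<i. coeff F j * coeff G (i - j)) + coeff F i * coeff G 0"
    by (simp flip: lessThan_Suc_atMost)
  finally have eq: "coeff (F * G) i = (\<Sum>j<i. coeff F j * coeff G (i - j)) + coeff F i * coeff G 0" .
  have "P dvd (\<Sum>j<i. coeff F j * coeff G (i - j))"
    using i(3) by (intro dvd_sum) auto
  moreover have "\<not> P dvd coeff F i * coeff G 0"
    using i(1) G0 \<open>prime P\<close> by (simp add: prime_dvd_mult_iff)
  ultimately have "\<not> P dvd coeff (F * G) i"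
    unfolding eq using dvd_add_right_iff by blast
  then have "degree (F * G) \<le> i"
    using low by (meson not_less)
  then show ?thesis
    using i(2) nz by (simp add: degree_mult_eq)
qed

text \<open>
  Eisenstein's criterion. Since \<open>P\<^sup>2\<close> does not divide the constant coefficient of the product, \<open>P\<close>
  does not divide the constant coefficients of both factors.
\<close>

lemma eisenstein:
  fixes F G :: "int poly"
  assumes "prime P" and "\<not> P dvd lead_coeff (F * G)"
    and "\<And>i. i < degree (F * G) \<Longrightarrow> P dvd coeff (F * G) i"
    and "\<not> P ^ 2 dvd coeff (F * G) 0"
  shows "degree F = 0 \<or> degree G = 0"
proof -
  have "\<not> P dvd coeff F 0 \<or> \<not> P dvd coeff G 0"
    using assms(4) by (auto simp: coeff_mult power2_eq_square mult_dvd_mono)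
  then show ?thesis
    using eisenstein_aux[of P F G] eisenstein_aux[of P G F] assms by (auto simp: mult.commute)
qed

text \<open>
  If \<open>q\<close> is a power of the prime \<open>p\<close>, this is the cyclotomic polynomial of index \<open>p * q\<close>, namely
  \<open>(X\<^bsup>pq\<^esup> - 1) / (X\<^bsup>q\<^esup> - 1)\<close>.
\<close>

definition cyclo :: "nat \<Rightarrow> nat \<Rightarrow> int poly" where
  "cyclo p q = (\<Sum>s<p. monom 1 (q * s))"

lemma monom_1_power: "monom (1 :: int) a ^ n = monom 1 (a * n)"
  by (induction n) (simp_all add: mult_monom)

lemma cyclo_mult: "cyclo p q * (monom 1 q - 1) = monom 1 (q * p) - 1"
proof -
  have "monom (1 :: int) q ^ p - 1 = (monom 1 q - 1) * (\<Sum>s<p. monom 1 q ^ s)"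
    by (rule power_diff_1_eq)
  then show ?thesis
    by (simp add: cyclo_def monom_1_power mult.commute)
qed

lemma coeff_cyclo:
  assumes "q > 0"
  shows "coeff (cyclo p q) l = (if q dvd l \<and> l < p * q then 1 else 0)"
proof -
  have "coeff (cyclo p q) l = (\<Sum>s<p. if q * s = l then 1 else 0)"
    by (simp add: cyclo_def coeff_sum)
  also have "\<dots> = (\<Sum>s\<in>{s. s < p \<and> q * s = l}. 1)"
    by (subst sum.If_cases) (auto intro!: arg_cong[of _ _ card])
  also have "{s. s < p \<and> q * s = l} = (if q dvd l \<and> l < p * q then {l div q} else {})"
    using assms by (auto simp: mult.commute)
  finally show ?thesis
    by auto
qed

lemma degree_cyclo:
  assumes "q > 0" "p > 0"
  shows "degree (cyclo p q) = q * (p - 1)"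
proof (rule antisym)
  show "degree (cyclo p q) \<le> q * (p - 1)"
  proof (rule degree_le, intro allI impI)
    fix l assume l: "q * (p - 1) < l"
    have "\<not> (q dvd l \<and> l < p * q)"
    proof
      assume "q dvd l \<and> l < p * q"
      then obtain s where s: "l = q * s" "q * s < p * q"
        by auto
      then have "s < p" "p - 1 < s"
        using l by (auto simp: mult.commute)
      then show False
        by simp
    qed
    then show "coeff (cyclo p q) l = 0"
      using assms by (simp add: coeff_cyclo)
  qed
  show "q * (p - 1) \<le> degree (cyclo p q)"
    using assms by (intro le_degree) (simp add: coeff_cyclo)
qed

lemma lead_coeff_cyclo:
  assumes "q > 0" "p > 0"
  shows "lead_coeff (cyclo p q) = 1"
  using assms by (simp add: degree_cyclo coeff_cyclo)

text \<open>
  The ring of integer polynomials has characteristic 0, so the congruence modulo \<open>p\<close> is expressed as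
  divisibility by the constant polynomial; the binomial coefficients strictly between the ends are
  divisible by \<open>p\<close>.
\<close>

lemma freshmans_dream_poly_mod:
  fixes x :: "int poly"
  assumes "prime p"
  shows "[:int p:] dvd (1 + x) ^ (p ^ m) - (1 + x ^ (p ^ m))"
proof (induction m)
  case 0
  then show ?case by simp
next
  case (Suc m)
  let ?y = "x ^ (p ^ m)"
  have "(1 + x) ^ (p ^ m) - (1 + ?y) dvd ((1 + x) ^ (p ^ m)) ^ p - (1 + ?y) ^ p"
    by (simp add: power_diff_sumr2)
  then have 1: "[:int p:] dvd ((1 + x) ^ (p ^ m)) ^ p - (1 + ?y) ^ p"
    using Suc dvd_trans by blast
  have "p > 0"
    using assms prime_gt_0_nat by blast
  have split: "{..p} = insert 0 (insert p {0<..<p})"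
    by auto
  have "(1 + ?y) ^ p = (\<Sum>k\<le>p. of_nat (p choose k) * ?y ^ k)"
    using binomial_ring[of ?y 1 p] by (simp add: add.commute)
  also have "\<dots> = 1 + ?y ^ p + (\<Sum>k\<in>{0<..<p}. of_nat (p choose k) * ?y ^ k)"
    using \<open>p > 0\<close> by (subst split) simp
  finally have "(1 + ?y) ^ p - (1 + ?y ^ p) = (\<Sum>k\<in>{0<..<p}. of_nat (p choose k) * ?y ^ k)"
    by simp
  moreover have "[:int p:] dvd (\<Sum>k\<in>{0<..<p}. of_nat (p choose k) * ?y ^ k)"
  proof (intro dvd_sum dvd_mult2)
    fix k assume "k \<in> {0<..<p}"
    then have "p dvd p choose k"
      using assms by (intro dvd_choose_prime) auto
    then show "[:int p:] dvd of_nat (p choose k)"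
      by (simp add: of_nat_poly const_poly_dvd_const_poly_iff)
  qed
  ultimately have 2: "[:int p:] dvd (1 + ?y) ^ p - (1 + ?y ^ p)"
    by simp
  have "[:int p:] dvd (((1 + x) ^ (p ^ m)) ^ p - (1 + ?y) ^ p) + ((1 + ?y) ^ p - (1 + ?y ^ p))"
    by (intro dvd_add 1 2)
  also have "\<dots> = (1 + x) ^ (p ^ Suc m) - (1 + x ^ (p ^ Suc m))"
    by (simp add: mult.commute flip: power_mult)
  finally show ?case .
qed

lemma pcompose_power: "pcompose (f ^ n) g = pcompose f g ^ n"
  by (induction n) (simp_all add: pcompose_mult pcompose_1)

text \<open>
  Modulo \<open>p\<close>, substituting \<open>1 + X\<close> turns \<open>X\<^bsup>pq\<^esup> - 1\<close> and \<open>X\<^bsup>q\<^esup> - 1\<close> into \<open>X\<^bsup>pq\<^esup>\<close> and \<open>X\<^bsup>q\<^esup>\<close>, so their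
  quotient becomes a pure power of \<open>X\<close>. This is the hypothesis of Eisenstein's criterion on the
  lower coefficients.
\<close>

lemma cyclo_shift:
  assumes "prime p" and q: "q = p ^ m"
  shows "[:int p:] dvd pcompose (cyclo p q) [:1, 1:] - monom 1 (q * (p - 1))"
proof -
  let ?X = "monom (1::int) 1" and ?P = "[:int p:]"
  define H where "H = pcompose (cyclo p q) [:1, 1:]"
  have X: "[:1, 1:] = 1 + ?X"
    by (simp add: monom_altdef one_pCons)
  have mon: "pcompose (monom 1 l) [:1, 1:] = (1 + ?X) ^ l" for l
    using pcompose_power[of ?X l "[:1,1:]"] by (simp add: monom_1_power X monom_altdef pcompose_pCons)
  have "pcompose (cyclo p q * (monom 1 q - 1)) [:1, 1:] = pcompose (monom 1 (q * p) - 1) [:1, 1:]"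
    by (simp add: cyclo_mult)
  then have eq: "H * ((1 + ?X) ^ q - 1) = (1 + ?X) ^ (q * p) - 1"
    by (simp only: pcompose_mult pcompose_diff mon pcompose_1 H_def)
  have "?P dvd (1 + ?X) ^ q - (1 + ?X ^ q)"
    unfolding q by (rule freshmans_dream_poly_mod) fact
  then have 1: "?P dvd H * ((1 + ?X) ^ q - (1 + ?X ^ q))"
    by (rule dvd_mult)
  have "?P dvd (1 + ?X) ^ (p ^ Suc m) - (1 + ?X ^ (p ^ Suc m))"
    by (rule freshmans_dream_poly_mod) fact
  then have 2: "?P dvd (1 + ?X) ^ (q * p) - (1 + ?X ^ (q * p))"
    by (simp add: q mult.commute)
  have "H * ?X ^ q - ?X ^ (q * p) =
      ((1 + ?X) ^ (q * p) - (1 + ?X ^ (q * p))) - H * ((1 + ?X) ^ q - (1 + ?X ^ q))"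
    using eq by (simp add: algebra_simps)
  then have 3: "?P dvd H * ?X ^ q - ?X ^ (q * p)"
    using 1 2 by (metis dvd_diff)
  have "q * p = q * (p - 1) + q"
    using prime_gt_0_nat[OF \<open>prime p\<close>] by (simp add: algebra_simps)
  then have "H * ?X ^ q - ?X ^ (q * p) = monom 1 q * (H - monom 1 (q * (p - 1)))"
    by (simp add: monom_1_power mult_monom algebra_simps)
  with 3 have "?P dvd monom 1 q * (H - monom 1 (q * (p - 1)))"
    by simp
  moreover have "prime_elem ?P"
    using assms by (simp add: prime_elem_const_poly_iff)
  moreover have "\<not> ?P dvd monom 1 q"
  proof
    assume "?P dvd monom 1 q"
    then have "int p dvd coeff (monom 1 q) q"
      by (simp only: const_poly_dvd_iff)
    then show False
      using assms by (simp add: prime_gt_1_nat)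
  qed
  ultimately show ?thesis
    using prime_elem_dvd_mult_iff H_def by blast
qed

text \<open>
  For odd \<open>p\<close>, a square root of \<open>(-1)\<^bsup>(p-1)/2\<^esup> p\<close>, the value of the quadratic Gauss sum. Unlike a
  square root of \<open>p\<close> itself, it always lies in the field of \<open>p\<close>-th roots of unity, and its argument
  decides between the two cases of the theorem.
\<close>

definition sqrt_pstar :: "nat \<Rightarrow> complex" where
  "sqrt_pstar p = (if p mod 4 = 1 then of_real (sqrt p) else \<i> * of_real (sqrt p))"

section \<open>Integer relations among the powers of a root of unity\<close>

text \<open>
  The two conditions on \<open>w\<close> say that it is a primitive root of unity of order \<open>p\<^bsup>m+1\<^esup>\<close>. Below,
  \<open>q = p\<^bsup>m\<^esup>\<close>, the order is \<open>p * q\<close>, and \<open>w\<^bsup>q\<^esup>\<close> is a primitive \<open>p\<close>-th root of unity. The ring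
  \<open>\<int>[w]\<close> consists of the numbers \<open>ipoly f w\<close>.
\<close>

locale prime_power_unity_root =
  fixes p m :: nat and w :: complex
  assumes prime: "prime p"
    and root: "w ^ (p ^ Suc m) = 1"
    and primitive: "w ^ (p ^ m) \<noteq> 1"
begin

definition q :: nat where "q = p ^ m"

lemma p_gt_1: "p > 1"
  using prime prime_gt_1_nat by blast

lemma p_pos [simp]: "p > 0"
  using p_gt_1 by simp

lemma q_pos [simp]: "q > 0"
  by (simp add: q_def)

lemma q_nz [simp]: "q \<noteq> 0"
  using q_pos by simp

lemma w_pow_N [simp]: "w ^ (p * q) = 1"
  using root by (simp add: q_def)

lemma w_nz [simp]: "w \<noteq> 0"
proof
  assume "w = 0"
  then show False
    using w_pow_N p_pos q_pos by (simp del: w_pow_N add: power_0_left)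
qed

lemma ipoly_cyclo [simp]: "ipoly (cyclo p q) w = 0"
proof -
  have "ipoly (cyclo p q * (monom 1 q - 1)) w = 0"
    unfolding cyclo_mult by (simp add: mult.commute)
  then show ?thesis
    using primitive by (simp add: q_def)
qed

text \<open>
  Pseudo-division of the cyclotomic polynomial by an annihilator \<open>f\<close> of least degree leaves no
  remainder, so by comparison of contents the primitive part of \<open>f\<close> divides it over the integers.
  Eisenstein's criterion after the shift by 1 allows only a constant cofactor.
\<close>

lemma degree_minimal_annihilator_ge:
  assumes f: "f \<noteq> 0" "ipoly f w = 0"
    and min: "\<And>g. g \<noteq> 0 \<Longrightarrow> ipoly g w = 0 \<Longrightarrow> degree f \<le> degree g"
  shows "q * (p - 1) \<le> degree f"
proof -
  let ?E = "cyclo p q"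
  define f' where "f' = primitive_part f"
  have fc: "f = smult (content f) f'"
    by (simp add: f'_def)
  have f'nz: "f' \<noteq> 0" and content_f': "content f' = 1"
    using f by (auto simp: f'_def)
  have "content f \<noteq> 0"
    using f by simp
  then have root_f': "ipoly f' w = 0"
    using f(2) by (subst (asm) fc) simp
  have deg_f': "degree f' = degree f"
    by (simp add: f'_def)
  obtain a g where a: "a \<noteq> 0" "smult a ?E = f' * g + pseudo_mod ?E f'"
    using pseudo_mod(1)[OF f'nz] by blast
  have "ipoly (pseudo_mod ?E f') w = 0"
    using arg_cong[OF a(2), of "\<lambda>h. ipoly h w"] root_f' by simp
  then have "pseudo_mod ?E f' = 0"
    using min[of "pseudo_mod ?E f'"] pseudo_mod(2)[OF f'nz, of ?E] deg_f' by fastforce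
  then have ag: "smult a ?E = f' * g"
    using a by simp
  have E1: "lead_coeff ?E = 1"
    by (rule lead_coeff_cyclo) simp_all
  have "content ?E = 1"
    using E1 content_dvd_coeff[of ?E "degree ?E"] normalize_content[of ?E]
    by (metis is_unit_normalize)
  then have "\<bar>a\<bar> = content g"
    using arg_cong[OF ag, of content] content_f' by (simp add: content_mult)
  then have "a dvd content g"
    by (metis abs_dvd_iff dvd_refl)
  then have "[:a:] dvd g"
    by (simp add: const_poly_dvd_iff_dvd_content)
  then obtain g' where g': "g = smult a g'"
    by (auto elim!: dvdE)
  have "smult a (?E - f' * g') = 0"
    using ag by (simp add: g' smult_diff_right)
  then have E: "?E = f' * g'"
    using a(1) by simp
  let ?c = "\<lambda>h. pcompose h [:1, 1::int:]"
  have H: "?c f' * ?c g' = ?c ?E"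
    by (simp add: E pcompose_mult)
  have deg: "degree (?c h) = degree h" for h
    by (simp add: degree_pcompose)
  have degE: "degree ?E = q * (p - 1)"
    by (simp add: degree_cyclo)
  have low: "int p dvd coeff (?c ?E) i" if "i < q * (p - 1)" for i
  proof -
    have "[:int p:] dvd ?c ?E - monom 1 (q * (p - 1))"
      by (rule cyclo_shift[OF prime q_def])
    then have "int p dvd coeff (?c ?E - monom 1 (q * (p - 1))) i"
      by (simp only: const_poly_dvd_iff)
    then show ?thesis
      using that by simp
  qed
  have lead: "lead_coeff (?c ?E) = 1"
    using lead_coeff_comp[of "[:1, 1::int:]" ?E] E1 by simp
  have "coeff (?c ?E) 0 = int p"
    by (simp add: cyclo_def poly_sum poly_monom)
  then have c0: "\<not> (int p)\<^sup>2 dvd coeff (?c ?E) 0"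
    using p_gt_1 by (auto simp: power2_eq_square dest!: zdvd_imp_le)
  have "degree (?c f') = 0 \<or> degree (?c g') = 0"
    by (rule eisenstein[of "int p"]) (use prime low lead c0 p_gt_1 in \<open>auto simp: H deg degE\<close>)
  then have "degree f' = 0 \<or> degree g' = 0"
    by (simp add: deg)
  moreover have "degree f' \<noteq> 0"
  proof
    assume "degree f' = 0"
    then obtain c where "f' = [:c:]"
      by (rule degree_eq_zeroE)
    then show False
      using f'nz root_f' by simp
  qed
  ultimately have "degree g' = 0"
    by simp
  moreover have "g' \<noteq> 0"
    using E E1 by auto
  ultimately have "degree ?E = degree f'"
    using f'nz unfolding E by (simp add: degree_mult_eq)
  then show ?thesis
    using deg_f' degE by simp
qed

lemma cyclo_dvd:
  assumes "ipoly h w = 0"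
  shows "cyclo p q dvd h"
proof -
  let ?E = "cyclo p q"
  \<comment> \<open>an annihilator of least degree has at least the degree of the cyclotomic polynomial\<close>
  have low: "r = 0" if r: "ipoly r w = 0" "degree r < q * (p - 1)" for r
  proof (rule ccontr)
    assume "r \<noteq> 0"
    define f where "f = arg_min degree (\<lambda>f. f \<noteq> 0 \<and> ipoly f w = 0)"
    have f: "(f \<noteq> 0 \<and> ipoly f w = 0) \<and> (\<forall>g. g \<noteq> 0 \<and> ipoly g w = 0 \<longrightarrow> degree f \<le> degree g)"
      unfolding f_def by (rule arg_min_nat_lemma[of _ r]) (use \<open>r \<noteq> 0\<close> r in auto)
    then have "q * (p - 1) \<le> degree f"
      by (intro degree_minimal_annihilator_ge) auto
    then show False
      using f r \<open>r \<noteq> 0\<close> by fastforce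
  qed
  have Enz: "?E \<noteq> 0"
    using lead_coeff_cyclo[of q p] by force
  have E1: "lead_coeff ?E = 1"
    by (rule lead_coeff_cyclo) simp_all
  \<comment> \<open>the divisor is monic, so pseudo-division is division with remainder\<close>
  obtain g r where gr: "h = ?E * g + r" "r = 0 \<or> degree r < degree ?E"
  proof -
    have "\<exists>g. h = ?E * g + pseudo_mod h ?E"
    proof -
      have "pseudo_divmod h ?E = (fst (pseudo_divmod h ?E), pseudo_mod h ?E)"
        by (simp add: pseudo_mod_def)
      from pseudo_divmod(1)[OF Enz this] show ?thesis
        by (auto simp: E1)
    qed
    then show ?thesis
      using that pseudo_mod(2)[OF Enz, of h] by blast
  qed
  have "ipoly r w = 0"
    using assms gr(1) by simp
  then have "r = 0"
    using low gr(2) by (auto simp: degree_cyclo)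
  then show ?thesis
    using gr(1) by simp
qed

text \<open>
  The cyclotomic polynomial takes the value \<open>p\<close> at 1. Hence evaluation at 1 modulo \<open>p\<close> is a
  well-defined ring homomorphism from \<open>\<int>[w]\<close> to the field with \<open>p\<close> elements; it is reduction modulo
  the prime element \<open>1 - w\<close>.
\<close>

lemma p_dvd_poly_1:
  assumes "ipoly h w = 0"
  shows "int p dvd poly h 1"
proof -
  obtain g where "h = cyclo p q * g"
    using cyclo_dvd[OF assms] by blast
  moreover have "poly (cyclo p q) 1 = int p"
    by (simp add: cyclo_def poly_sum poly_monom)
  ultimately show ?thesis
    by simp
qed

text \<open>
  A multiple of the cyclotomic polynomial \<open>\<Sum>\<^sub>s X\<^bsup>qs\<^esup>\<close> of degree below \<open>p * q\<close> has a cofactor of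
  degree below \<open>q\<close>, and the \<open>p\<close> shifted copies of this cofactor do not overlap. So the only integer
  relations among the powers of \<open>w\<close> are the combinations of the obvious ones.
\<close>

lemma coeffs_periodic:
  fixes d :: "nat \<Rightarrow> int"
  assumes sum0: "(\<Sum>l<p * q. of_int (d l) * w ^ l) = 0" and "j < q" "s < p"
  shows "d (j + q * s) = d j"
proof -
  define h where "h = (\<Sum>l<p * q. monom (d l) l)"
  have coeff_h: "coeff h l = (if l < p * q then d l else 0)" for l
    by (simp add: h_def coeff_sum)
  have "ipoly h w = 0"
    using sum0 by (simp add: h_def)
  then obtain g where g: "h = cyclo p q * g"
    using cyclo_dvd by blast
  have pq: "q * (p - 1) + q = p * q"
    using p_gt_1 by (cases p) simp_all
  have deg_g: "coeff g l = 0" if "l \<ge> q" for l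
  proof (cases "g = 0")
    case False
    have "degree h = q * (p - 1) + degree g"
      unfolding g using False lead_coeff_cyclo[of q p]
      by (subst degree_mult_eq) (auto simp: degree_cyclo)
    moreover have "degree h < p * q"
      by (rule le_less_trans[OF degree_le[of "p * q - 1"]]) (auto simp: coeff_h)
    ultimately have "degree g < q"
      using pq by linarith
    then show ?thesis
      using that by (intro coeff_eq_0) simp
  qed simp
  have coeff: "coeff h (j + q * s) = coeff g j" if "s < p" for s
  proof -
    have "coeff h (j + q * s) = (\<Sum>t<p. coeff (monom 1 (q * t) * g) (j + q * s))"
      by (simp add: g cyclo_def sum_distrib_right coeff_sum)
    also have "\<dots> = (\<Sum>t<p. if t = s then coeff g j else 0)"
    proof (rule sum.cong[OF refl])
      fix t
      consider "t < s" | "t = s" | "s < t"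
        by linarith
      then show "coeff (monom 1 (q * t) * g) (j + q * s) = (if t = s then coeff g j else 0)"
      proof cases
        case 1
        then have "q * t + q \<le> q * s"
          by (metis Suc_leI mult_Suc_right add.commute mult_le_mono2)
        then show ?thesis
          using 1 by (simp add: coeff_monom_mult deg_g)
      next
        case 3
        then have "q * s + q \<le> q * t"
          by (metis Suc_leI mult_Suc_right add.commute mult_le_mono2)
        then show ?thesis
          using 3 \<open>j < q\<close> by (simp add: coeff_monom_mult)
      qed (simp add: coeff_monom_mult)
    qed
    also have "\<dots> = coeff g j"
      using that by simp
    finally show ?thesis .
  qed
  have lt: "j + q * s < p * q" if "s < p" for s
  proof -
    have "j + q * s < q * Suc s" using \<open>j < q\<close> by simp
    also have "\<dots> \<le> q * p" using that by (intro mult_le_mono2) simp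
    finally show ?thesis by (simp add: mult.commute)
  qed
  show ?thesis
    using coeff[of s] coeff[of 0] lt[of s] lt[of 0] \<open>s < p\<close> by (simp add: coeff_h)
qed

section \<open>Powers of the root of unity\<close>

lemma w_pow_mod [simp]: "w ^ (t mod (p * q)) = w ^ t"
proof -
  have "w ^ t = w ^ (p * q * (t div (p * q)) + t mod (p * q))"
    by simp
  also have "\<dots> = (w ^ (p * q)) ^ (t div (p * q)) * w ^ (t mod (p * q))"
    unfolding power_add power_mult ..
  finally show ?thesis
    by simp
qed

lemma w_pow_cong: "[s = t] (mod (p * q)) \<Longrightarrow> w ^ s = w ^ t"
  by (metis cong_def w_pow_mod)

text \<open>
  If \<open>w\<^bsup>t\<^esup> = 1\<close>, then also \<open>w\<close> to the power \<open>gcd (p * q) t\<close> is 1. This exponent is a power of \<open>p\<close> and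
  does not divide \<open>q\<close> because \<open>w\<^bsup>q\<^esup>\<close> differs from 1, so it is \<open>p * q\<close>.
\<close>

lemma w_pow_eq_1_iff: "w ^ t = 1 \<longleftrightarrow> p * q dvd t"
proof
  assume t: "w ^ t = 1"
  obtain x y where xy: "p * q * x = t * y + gcd (p * q) t"
    using bezout_nat[of "p * q" t] by auto
  have "(w ^ (p * q)) ^ x = (w ^ t) ^ y * w ^ gcd (p * q) t"
    by (simp only: xy flip: power_mult power_add)
  then have g: "w ^ gcd (p * q) t = 1"
    using t by simp
  have "gcd (p * q) t dvd p ^ Suc m"
    by (simp add: q_def)
  then obtain i where i: "i \<le> Suc m" "gcd (p * q) t = p ^ i"
    using divides_primepow_nat[OF prime] by blast
  have "\<not> i \<le> m"
  proof
    assume "i \<le> m"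
    then have "p ^ i dvd p ^ m"
      by (rule le_imp_power_dvd)
    then have "w ^ (p ^ m) = 1"
      using g i(2) by (metis dvdE power_mult power_one)
    then show False
      using primitive by simp
  qed
  then have "i = Suc m"
    using i(1) by simp
  then have "gcd (p * q) t = p * q"
    using i(2) by (simp add: q_def)
  then show "p * q dvd t"
    by (metis gcd_dvd2)
next
  assume "p * q dvd t"
  then show "w ^ t = 1"
    by (metis dvdE power_mult power_one w_pow_N)
qed

lemma norm_w [simp]: "norm w = 1"
proof -
  have "norm w ^ (p * q) = 1"
    by (metis norm_one norm_power w_pow_N)
  then show ?thesis
    by (metis norm_ge_zero p_pos q_pos nat_0_less_mult_iff power_eq_1_iff less_numeral_extra(3) real_norm_def abs_norm_cancel)
qed

lemma w_mult_cnj: "w * cnj w = 1"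
  by (simp add: complex_norm_square[symmetric])

lemma cnj_w: "cnj w = w ^ (p * q - 1)"
proof -
  have "w * w ^ (p * q - 1) = 1"
    by (metis p_pos q_pos nat_0_less_mult_iff power_minus_mult mult.commute w_pow_N)
  then show ?thesis
    using w_mult_cnj by (metis mult_cancel_left w_nz)
qed

lemma w_pow_mult_cnj: "w ^ t * cnj (w ^ t) = 1"
  using w_mult_cnj by (metis complex_cnj_power power_mult_distrib power_one)

lemma coprime_N_iff: "coprime t (p * q) \<longleftrightarrow> \<not> p dvd t"
proof
  assume "coprime t (p * q)"
  then show "\<not> p dvd t"
    using p_gt_1 by (metis coprime_common_divisor_nat dvd_triv_left nat_neq_iff)
next
  assume "\<not> p dvd t"
  then have "coprime p t"
    using prime prime_imp_coprime by blast
  then show "coprime t (p * q)"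
    by (simp add: q_def coprime_commute)
qed

lemma unity_root_power:
  assumes "coprime t (p * q)"
  shows "prime_power_unity_root p m (w ^ t)"
proof
  have "(w ^ t) ^ (p ^ Suc m) = (w ^ (p ^ Suc m)) ^ t"
    by (simp only: mult.commute flip: power_mult)
  then show "(w ^ t) ^ (p ^ Suc m) = 1"
    by (simp only: root power_one)
  have "\<not> p * q dvd t * q"
    using assms coprime_N_iff by simp
  then show "(w ^ t) ^ p ^ m \<noteq> 1"
    by (metis w_pow_eq_1_iff power_mult q_def)
qed (fact prime)

lemma unity_root_power_q: "prime_power_unity_root p 0 (w ^ q)"
  using prime primitive root
  by unfold_locales (simp_all add: q_def power_mult mult.commute flip: power_mult)

lemma inj_on_w_pow: "inj_on (\<lambda>t. w ^ t) (totatives (p * q))"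
proof (rule linorder_inj_onI)
  fix s t assume st: "s < t" "s \<in> totatives (p * q)" "t \<in> totatives (p * q)"
  have "w ^ t = w ^ s * w ^ (t - s)"
    using st(1) by (simp flip: power_add)
  moreover have "t - s < p * q"
    using st by (auto simp: in_totatives_iff)
  then have "\<not> p * q dvd t - s"
    using st(1) by (auto dest: dvd_imp_le)
  ultimately show "w ^ s \<noteq> w ^ t"
    by (simp add: w_pow_eq_1_iff)
qed auto

lemma card_totatives_N: "card (totatives (p * q)) = q * (p - 1)"
  using totient_prime_power[OF prime, of "Suc m"] by (simp add: totient_def q_def)

text \<open>
  The powers of \<open>w\<close> with exponents prime to \<open>p\<close> are roots of the cyclotomic polynomial, and there
  are as many of them as its degree. The product is therefore its value at 1.
\<close>

lemma prod_totatives: "(\<Prod>t\<in>totatives (p * q). 1 - w ^ t) = of_nat p"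
proof -
  let ?T = "totatives (p * q)" and ?n = "q * (p - 1)"
  define F :: "complex poly" where "F = map_poly of_int (cyclo p q)"
  define G where "G = (\<Prod>t\<in>?T. [:- (w ^ t), 1:])"
  have degG: "degree G = ?n"
    unfolding G_def by (subst degree_prod_eq_sum_degree) (simp_all add: card_totatives_N)
  have leadG: "lead_coeff G = 1"
    by (simp add: G_def lead_coeff_prod)
  have cF: "coeff F l = of_int (coeff (cyclo p q) l)" for l
    by (simp add: F_def coeff_map_poly)
  have "F = G"
  proof (rule poly_eqI_degree_lead_coeff[of _ ?n _ "(\<lambda>t. w ^ t) ` ?T"])
    show "coeff F ?n = coeff G ?n"
      using lead_coeff_cyclo[of q p] leadG by (simp add: cF degree_cyclo degG)
    show "?n \<le> card ((\<lambda>t. w ^ t) ` ?T)"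
      by (simp add: card_image[OF inj_on_w_pow] card_totatives_N)
    show "degree F \<le> ?n"
      by (rule degree_le) (auto simp: cF coeff_eq_0 degree_cyclo)
    show "degree G \<le> ?n"
      by (simp add: degG)
    fix z assume "z \<in> (\<lambda>t. w ^ t) ` ?T"
    then obtain t where t: "t \<in> ?T" "z = w ^ t"
      by blast
    then interpret t: prime_power_unity_root p m "w ^ t"
      by (intro unity_root_power) (simp add: in_totatives_iff)
    have "poly F z = 0"
      using t.ipoly_cyclo by (simp add: F_def ipoly_def t(2) t.q_def q_def)
    moreover have "poly G z = 0"
      using t by (auto simp: G_def poly_prod)
    ultimately show "poly F z = poly G z"
      by simp
  qed
  then have "poly G 1 = ipoly (cyclo p q) 1"
    by (simp add: ipoly_def F_def)
  then show ?thesis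
    by (simp add: G_def poly_prod cyclo_def)
qed

section \<open>A square root of p as a product of primes of the cyclotomic field\<close>

text \<open>
  For odd \<open>p\<close>, one out of each pair \<open>t\<close>, \<open>p * q - t\<close> of exponents prime to \<open>p\<close>, that is, one factor \<open>1 - w\<^bsup>t\<^esup>\<close> out of
  each pair of complex conjugates in the factorisation of \<open>p\<close>.
\<close>

definition half_totatives :: "nat set" where
  "half_totatives = {t \<in> totatives (p * q). 2 * t < p * q}"

definition half_prod :: complex where
  "half_prod = (\<Prod>t\<in>half_totatives. 1 - w ^ t)"

lemma finite_half_totatives [simp]: "finite half_totatives"
  by (simp add: half_totatives_def)

lemma half_totatives_coprime: "t \<in> half_totatives \<Longrightarrow> coprime t (p * q)"
  by (simp add: half_totatives_def in_totatives_iff)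

lemma totatives_split:
  assumes "odd p"
  shows "totatives (p * q) = half_totatives \<union> (\<lambda>t. p * q - t) ` half_totatives" "half_totatives \<inter> (\<lambda>t. p * q - t) ` half_totatives = {}"
    "inj_on (\<lambda>t. p * q - t) half_totatives"
proof -
  have oddN: "odd (p * q)"
    using assms by (simp add: q_def)
  have N: "p * q > 1"
    using p_gt_1 q_pos by (metis less_1_mult mult.right_neutral Suc_lessI One_nat_def)
  have reflect: "p * q - t \<in> totatives (p * q)" if "t \<in> totatives (p * q)" for t
  proof -
    have "t < p * q"
      using totatives_less[OF that N] .
    moreover have "coprime (p * q - t) (p * q)"
      using that coprime_diff_one_left_nat
      by (metis calculation coprime_commute gcd_diff1_nat gcd_diff2_nat coprime_iff_gcd_eq_1 in_totatives_iff less_imp_le)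
    ultimately show ?thesis
      by (simp add: in_totatives_iff)
  qed
  show "totatives (p * q) = half_totatives \<union> (\<lambda>t. p * q - t) ` half_totatives"
  proof (intro equalityI subsetI)
    fix t assume t: "t \<in> totatives (p * q)"
    show "t \<in> half_totatives \<union> (\<lambda>t. p * q - t) ` half_totatives"
    proof (cases "2 * t < p * q")
      case True
      then show ?thesis
        using t by (simp add: half_totatives_def)
    next
      case False
      moreover have "2 * t \<noteq> p * q"
        using oddN by (metis dvd_triv_left)
      ultimately have "2 * (p * q - t) < p * q"
        using N by linarith
      then have "p * q - t \<in> half_totatives"
        using reflect[OF t] by (simp add: half_totatives_def)
      moreover have "t = p * q - (p * q - t)"
        using totatives_less[OF t N] by simp
      ultimately show ?thesis
        by blast
    qed
  qed (auto simp: half_totatives_def reflect)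
  show "half_totatives \<inter> (\<lambda>t. p * q - t) ` half_totatives = {}"
    by (auto simp: half_totatives_def)
  show "inj_on (\<lambda>t. p * q - t) half_totatives"
    by (rule inj_onI) (auto simp: half_totatives_def)
qed

lemma w_pow_reflect:
  assumes "t \<le> p * q"
  shows "w ^ (p * q - t) = cnj (w ^ t)"
proof -
  have "w ^ (p * q - t) * w ^ t = 1"
    using assms by (simp flip: power_add)
  then show ?thesis
    using w_pow_mult_cnj[of t] by (metis mult.commute mult_cancel_left power_not_zero w_nz)
qed

lemma half_prod_mult_cnj:
  assumes "odd p"
  shows "half_prod * cnj half_prod = of_nat p"
proof -
  have "of_nat p = (\<Prod>t\<in>half_totatives. 1 - w ^ t) * (\<Prod>t\<in>(\<lambda>t. p * q - t) ` half_totatives. 1 - w ^ t)"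
    using totatives_split[OF assms] prod_totatives prod.union_disjoint[of half_totatives "(\<lambda>t. p * q - t) ` half_totatives" "\<lambda>t. 1 - w ^ t"]
    by simp
  also have "(\<Prod>t\<in>(\<lambda>t. p * q - t) ` half_totatives. 1 - w ^ t) = (\<Prod>t\<in>half_totatives. 1 - w ^ (p * q - t))"
    using totatives_split(3)[OF assms] by (simp add: prod.reindex)
  also have "\<dots> = cnj half_prod"
    unfolding half_prod_def cnj_prod
    by (intro prod.cong refl) (auto simp: w_pow_reflect half_totatives_def)
  finally show ?thesis
    by (simp add: half_prod_def)
qed

lemma card_half_totatives:
  assumes "odd p"
  shows "card half_totatives = q * ((p - 1) div 2)"
proof -
  have "q * (p - 1) = card half_totatives + card half_totatives"
    using totatives_split[OF assms] card_totatives_N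
    by (metis card_Un_disjoint card_image finite_half_totatives finite_imageI)
  moreover have "p - 1 = 2 * ((p - 1) div 2)"
    using assms p_pos by (auto elim: oddE)
  ultimately show ?thesis
    by (metis mult_2 mult.left_commute mult_left_cancel zero_neq_numeral)
qed

lemma sqrt_pstar_power2:
  assumes "odd p"
  shows "sqrt_pstar p ^ 2 = (-1) ^ card half_totatives * of_nat p"
proof -
  have "odd q"
    using assms by (simp add: q_def)
  then have "(-1 :: complex) ^ card half_totatives = (-1) ^ ((p - 1) div 2)"
    by (simp add: card_half_totatives[OF assms] uminus_power_if)
  moreover have "even ((p - 1) div 2) \<longleftrightarrow> p mod 4 = 1"
    using assms by presburger
  ultimately show ?thesis
    by (auto simp: sqrt_pstar_def power_mult_distrib simp flip: of_real_power)
qed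

text \<open>
  The factor \<open>1 - w\<^bsup>t\<^esup>\<close> is \<open>- w\<^bsup>t\<^esup>\<close> times its conjugate, so the square of the half product is its
  squared absolute value \<open>p\<close> up to sign and a power of \<open>w\<close>. As \<open>w\<close> has odd order, every power
  of \<open>w\<close> is a square.
\<close>

lemma half_prod_eq:
  assumes "odd p"
  shows "\<exists>e. half_prod = sqrt_pstar p * w ^ e \<or> half_prod = - (sqrt_pstar p * w ^ e)"
proof -
  have sq: "(1 - w ^ t) ^ 2 = - (w ^ t) * ((1 - w ^ t) * cnj (1 - w ^ t))" for t
    using w_pow_mult_cnj[of t] by (simp add: power2_eq_square algebra_simps)
  have "half_prod ^ 2 = (\<Prod>t\<in>half_totatives. - (w ^ t) * ((1 - w ^ t) * cnj (1 - w ^ t)))"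
    unfolding half_prod_def prod_power_distrib sq ..
  also have "\<dots> = (\<Prod>t\<in>half_totatives. - (w ^ t)) * (half_prod * cnj half_prod)"
    by (simp only: half_prod_def prod.distrib cnj_prod)
  also have "(\<Prod>t\<in>half_totatives. - (w ^ t)) = (-1) ^ card half_totatives * w ^ (\<Sum>half_totatives)"
    by (simp add: prod_uminus power_sum)
  finally have Q2: "half_prod ^ 2 = (-1) ^ card half_totatives * w ^ (\<Sum>half_totatives) * of_nat p"
    by (simp add: half_prod_mult_cnj[OF assms])
  obtain e where e: "w ^ (\<Sum>half_totatives) = (w ^ e) ^ 2"
  proof (cases "even (\<Sum>half_totatives)")
    case True
    then show ?thesis
      using that[of "\<Sum>half_totatives div 2"] by (simp flip: power_mult)
  next
    case False
    \<comment> \<open>an odd exponent becomes even after adding the odd order of \<open>w\<close>\<close>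
    have "odd (p * q)"
      using assms by (simp add: q_def)
    then have "(\<Sum>half_totatives + p * q) div 2 * 2 = \<Sum>half_totatives + p * q"
      using False by simp
    then have "(w ^ ((\<Sum>half_totatives + p * q) div 2)) ^ 2 = w ^ (\<Sum>half_totatives)"
      by (simp add: power_add flip: power_mult)
    then show ?thesis
      using that by metis
  qed
  have "half_prod ^ 2 = (sqrt_pstar p * w ^ e) ^ 2"
    by (simp add: Q2 e power_mult_distrib sqrt_pstar_power2[OF assms])
  then show ?thesis
    using power2_eq_iff by blast
qed

section \<open>Splitting off the primes above p\<close>

text \<open>
  With \<open>t'\<close> an inverse of \<open>t\<close> modulo \<open>p * q\<close>, the root \<open>w\<close> is the \<open>t'\<close>-th power of \<open>w\<^bsup>t\<^esup>\<close>.
\<close>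

lemma one_minus_w_dvd:
  assumes "coprime t (p * q)"
  shows "\<exists>f. 1 - w = (1 - w ^ t) * ipoly f w"
proof -
  obtain t' where "[t * t' = 1] (mod (p * q))"
    using cong_solve_coprime_nat[OF assms] by auto
  then have "w = (w ^ t) ^ t'"
    using w_pow_cong by (metis power_mult power_one_right)
  then have "1 - w = 1 - (w ^ t) ^ t'"
    by simp
  also have "\<dots> = (1 - w ^ t) * (\<Sum>i<t'. (w ^ t) ^ i)"
    by (rule one_diff_power_eq)
  also have "(\<Sum>i<t'. (w ^ t) ^ i) = ipoly (\<Sum>i<t'. monom 1 (t * i)) w"
    by (simp add: power_mult)
  finally show ?thesis
    by blast
qed

lemma poly_minus_value_factor: "\<exists>k. f = [:poly f 1:] + [:1, -1:] * (k :: int poly)"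
proof -
  have "[:- 1, 1:] dvd f - [:poly f 1:]"
    by (simp add: dvd_iff_poly_eq_0)
  then obtain k where "f - [:poly f 1:] = [:- 1, 1:] * k"
    by blast
  then have "f = [:poly f 1:] + [:1, -1:] * (- k)"
    by (simp add: algebra_simps)
  then show ?thesis
    by blast
qed

text \<open>
  The converse direction of the reduction modulo \<open>1 - w\<close>: modulo this element \<open>f(w)\<close> is congruent
  to \<open>f(1)\<close>, and \<open>p\<close> itself is a multiple of it.
\<close>

lemma one_minus_w_dvd_of_p_dvd:
  assumes "int p dvd poly f 1"
  shows "\<exists>g. ipoly f w = (1 - w) * ipoly g w"
proof -
  obtain k where k: "f = [:poly f 1:] + [:1, -1:] * k"
    using poly_minus_value_factor by blast
  obtain l where l: "cyclo p q = [:poly (cyclo p q) 1:] + [:1, -1:] * l"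
    using poly_minus_value_factor by blast
  have "poly (cyclo p q) 1 = int p"
    by (simp add: cyclo_def poly_sum poly_monom)
  then have "0 = of_nat p + (1 - w) * ipoly l w"
    using arg_cong[OF l, of "\<lambda>h. ipoly h w"] by (simp add: algebra_simps)
  then have p: "of_nat p = (1 - w) * (- ipoly l w)"
    by (simp add: add_eq_0_iff)
  obtain c where c: "poly f 1 = int p * c"
    using assms by blast
  have "ipoly f w = of_int c * of_nat p + (1 - w) * ipoly k w"
    using arg_cong[OF k, of "\<lambda>h. ipoly h w"] by (simp add: c algebra_simps)
  also have "\<dots> = (1 - w) * ipoly (k - smult c l) w"
    unfolding p by (simp add: algebra_simps)
  finally show ?thesis
    by blast
qed

text \<open>
  Complex conjugation on \<open>\<int>[w]\<close>, lifted to polynomials: the conjugate of \<open>w\<close> is its power with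
  exponent \<open>p * q - 1\<close>.
\<close>

definition conj_poly :: "int poly \<Rightarrow> int poly" where
  "conj_poly f = pcompose f (monom 1 (p * q - 1))"

lemma ipoly_conj_poly [simp]: "ipoly (conj_poly f) w = cnj (ipoly f w)"
  by (simp add: conj_poly_def cnj_ipoly cnj_w)

lemma poly_conj_poly_1 [simp]: "poly (conj_poly f) 1 = poly f 1"
  by (simp add: conj_poly_def poly_pcompose poly_monom)

text \<open>
  Reduction modulo \<open>1 - w\<close> maps an element and its conjugate to the same residue, and the norm
  equation makes the square of this residue zero. So \<open>1 - w\<close>, and with it \<open>1 - w\<^bsup>t\<^esup>\<close>, divides the
  element, and the pair of conjugate factors cancels from the equation. This replaces the ideal
  factorisation of \<open>p\<close>.
\<close>

lemma split_off_factor: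
  assumes t: "coprime t (p * q)"
    and norm: "ipoly f w * cnj (ipoly f w) = (1 - w ^ t) * cnj (1 - w ^ t) * ipoly v w"
  shows "\<exists>g. ipoly f w = (1 - w ^ t) * ipoly g w \<and> ipoly g w * cnj (ipoly g w) = ipoly v w"
proof -
  let ?a = "1 - monom 1 t :: int poly"
  have "int p dvd poly (f * conj_poly f - ?a * conj_poly ?a * v) 1"
    by (rule p_dvd_poly_1) (simp add: norm)
  then have "int p dvd poly f 1 * poly f 1"
    by (simp add: poly_monom)
  then have "int p dvd poly f 1"
    using prime by (simp add: prime_dvd_mult_iff)
  then obtain g where g: "ipoly f w = (1 - w) * ipoly g w"
    using one_minus_w_dvd_of_p_dvd by blast
  obtain h where h: "1 - w = (1 - w ^ t) * ipoly h w"
    using one_minus_w_dvd[OF t] by blast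
  have eq: "ipoly f w = (1 - w ^ t) * ipoly (h * g) w"
    by (simp add: g h)
  have "\<not> p * q dvd t"
    using t coprime_N_iff by (metis dvd_mult_left)
  then have nz: "1 - w ^ t \<noteq> 0"
    by (metis right_minus_eq w_pow_eq_1_iff)
  have "((1 - w ^ t) * cnj (1 - w ^ t)) * (ipoly (h * g) w * cnj (ipoly (h * g) w))
      = ((1 - w ^ t) * cnj (1 - w ^ t)) * ipoly v w"
    using norm unfolding eq by (simp add: mult_ac)
  moreover have "(1 - w ^ t) * cnj (1 - w ^ t) \<noteq> 0"
    using nz by (simp only: mult_eq_0_iff complex_cnj_zero_iff, simp)
  ultimately have "ipoly (h * g) w * cnj (ipoly (h * g) w) = ipoly v w"
    using mult_left_cancel by blast
  with eq show ?thesis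
    by blast
qed

lemma split_off_prod:
  assumes "finite A" "\<And>t. t \<in> A \<Longrightarrow> coprime t (p * q)"
    and "ipoly f w * cnj (ipoly f w) = (\<Prod>t\<in>A. 1 - w ^ t) * cnj (\<Prod>t\<in>A. 1 - w ^ t) * ipoly v w"
  shows "\<exists>g. ipoly f w = (\<Prod>t\<in>A. 1 - w ^ t) * ipoly g w \<and> ipoly g w * cnj (ipoly g w) = ipoly v w"
  using assms
proof (induction A arbitrary: f)
  case empty
  then show ?case by auto
next
  case (insert t A)
  let ?b = "(\<Prod>t\<in>A. 1 - w ^ t)" and ?B = "\<Prod>t\<in>A. 1 - monom 1 t :: int poly"
  have B: "ipoly ?B w = ?b"
    by (induction A rule: infinite_finite_induct) simp_all
  have "ipoly f w * cnj (ipoly f w) = (1 - w ^ t) * cnj (1 - w ^ t) * ipoly (?B * conj_poly ?B * v) w"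
    using insert.prems(2) insert.hyps by (simp add: B mult_ac)
  then obtain g where g: "ipoly f w = (1 - w ^ t) * ipoly g w"
      "ipoly g w * cnj (ipoly g w) = ipoly (?B * conj_poly ?B * v) w"
    using split_off_factor[of t f "?B * conj_poly ?B * v"] insert.prems(1) by blast
  have "ipoly g w * cnj (ipoly g w) = ?b * cnj ?b * ipoly v w"
    using g(2) by (simp add: B)
  then obtain g' where "ipoly g w = ?b * ipoly g' w" "ipoly g' w * cnj (ipoly g' w) = ipoly v w"
    using insert.IH insert.prems(1) by (metis insertI2)
  then show ?case
    using g(1) insert.hyps by (auto simp: mult_ac)
qed

lemma split_off_half_prod_power:
  assumes "odd p" "ipoly f w * cnj (ipoly f w) = of_nat p ^ n"
  shows "\<exists>g. ipoly f w = half_prod ^ n * ipoly g w \<and> ipoly g w * cnj (ipoly g w) = 1"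
  using assms(2)
proof (induction n arbitrary: f)
  case 0
  then show ?case by auto
next
  case (Suc n)
  have "ipoly f w * cnj (ipoly f w) = half_prod * cnj half_prod * ipoly [:int p ^ n:] w"
    using Suc.prems by (simp add: half_prod_mult_cnj[OF assms(1)])
  then obtain g where g: "ipoly f w = half_prod * ipoly g w" "ipoly g w * cnj (ipoly g w) = of_nat p ^ n"
    using split_off_prod[of half_totatives f "[:int p ^ n:]"] half_totatives_coprime by (auto simp: half_prod_def)
  then obtain g' where "ipoly g w = half_prod ^ n * ipoly g' w" "ipoly g' w * cnj (ipoly g' w) = 1"
    using Suc.IH by blast
  then show ?case
    using g(1) by auto
qed

end

section \<open>Elements of absolute value one\<close>

lemma sum_lessThan_mult:
  fixes g :: "nat \<Rightarrow> 'a :: comm_monoid_add"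
  shows "(\<Sum>l<p * q. g l) = (\<Sum>j<q. \<Sum>s<p. g (j + q * s))"
proof -
  have "(\<Sum>l<p * q. g l) = (\<Sum>s<p. \<Sum>l\<in>{s * q..<s * q + q}. g l)"
    by (simp add: sum.nat_group)
  also have "\<dots> = (\<Sum>s<p. \<Sum>j<q. g (j + q * s))"
  proof (rule sum.cong[OF refl])
    fix s
    have "{s * q..<s * q + q} = (\<lambda>j. j + q * s) ` {..<q}"
      using image_add_atLeastLessThan'[of "q * s" 0 q] by (simp add: mult.commute add.commute lessThan_atLeast0)
    then show "(\<Sum>l\<in>{s * q..<s * q + q}. g l) = (\<Sum>j<q. g (j + q * s))"
      by (simp add: sum.reindex)
  qed
  also have "\<dots> = (\<Sum>j<q. \<Sum>s<p. g (j + q * s))"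
    by (rule sum.swap)
  finally show ?thesis .
qed

text \<open>
  The right-hand side, twice an unnormalised variance, is what the trace computation below yields;
  the left-hand side shows that it detects constancy.
\<close>

lemma double_sum_diff_squares:
  fixes v :: "'a \<Rightarrow> int"
  shows "(\<Sum>s\<in>S. \<Sum>t\<in>S. (v s - v t) ^ 2) = 2 * (int (card S) * (\<Sum>s\<in>S. v s ^ 2) - (\<Sum>s\<in>S. v s) ^ 2)"
proof -
  have "(\<Sum>s\<in>S. \<Sum>t\<in>S. (v s - v t) ^ 2) = (\<Sum>s\<in>S. \<Sum>t\<in>S. v s ^ 2 + v t ^ 2 - 2 * (v s * v t))"
    by (simp add: power2_diff algebra_simps)
  also have "\<dots> = 2 * (int (card S) * (\<Sum>s\<in>S. v s ^ 2)) - 2 * (\<Sum>s\<in>S. \<Sum>t\<in>S. v s * v t)"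
    by (simp add: sum.distrib sum_subtractf sum_distrib_left)
  also have "(\<Sum>s\<in>S. \<Sum>t\<in>S. v s * v t) = (\<Sum>s\<in>S. v s) ^ 2"
    by (simp add: power2_eq_square sum_product)
  finally show ?thesis
    by simp
qed

lemma mult_ge_add_minus_one:
  fixes a b c :: int
  assumes "a \<ge> 1" "b \<ge> 1"
  shows "a * b \<ge> a + b - 1" "a * b = a + b - 1 \<Longrightarrow> a = 1 \<or> b = 1"
proof -
  have eq: "a * b - (a + b - 1) = (a - 1) * (b - 1)"
    by (simp add: algebra_simps)
  moreover have "(a - 1) * (b - 1) \<ge> 0"
    using assms by simp
  ultimately show "a * b \<ge> a + b - 1"
    by linarith
  assume "a * b = a + b - 1"
  then show "a = 1 \<or> b = 1"
    using eq by simp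
qed

text \<open>
  Split \<open>S\<close> into the set \<open>A\<close> on which \<open>v\<close> takes the value \<open>v s1\<close> and its complement \<open>B\<close>. Each of
  the \<open>card A * card B\<close> pairs across contributes at least 1, and this product is at least
  \<open>card S - 1\<close>. Equality forces one of the two parts to be a single point, all differences across
  to be \<open>\<plusminus>1\<close>, and \<open>v\<close> to be constant on \<open>B\<close>.
\<close>

lemma nonconstant_variance:
  fixes v :: "'a \<Rightarrow> int"
  assumes "finite S" and s1: "s1 \<in> S" and s2: "s2 \<in> S" "v s2 \<noteq> v s1"
  defines "V \<equiv> int (card S) * (\<Sum>s\<in>S. v s ^ 2) - (\<Sum>s\<in>S. v s) ^ 2"
  shows "V \<ge> int (card S) - 1"
    and "V = int (card S) - 1 \<Longrightarrow>
      \<exists>s0\<in>S. \<exists>a e. (e = 1 \<or> e = -1) \<and> (\<forall>s\<in>S. v s = a + (if s = s0 then e else 0))"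
proof -
  define A where "A = {s \<in> S. v s = v s1}"
  define B where "B = {s \<in> S. v s \<noteq> v s1}"
  define D where "D = (\<lambda>s t. (v s - v t) ^ 2)"
  have S: "S = A \<union> B" "A \<inter> B = {}" and fin: "finite A" "finite B"
    using \<open>finite S\<close> by (auto simp: A_def B_def)
  have split: "sum g S = sum g A + sum g B" for g :: "'a \<Rightarrow> int"
    unfolding S(1) by (rule sum.union_disjoint) (use fin S(2) in auto)
  define x where "x = (\<Sum>s\<in>A. \<Sum>t\<in>B. D s t)"
  define y where "y = (\<Sum>s\<in>B. \<Sum>t\<in>B. D s t)"
  have sym: "(\<Sum>s\<in>B. \<Sum>t\<in>A. D s t) = x"
    unfolding x_def by (subst sum.swap) (simp add: D_def power2_commute)
  have AA: "(\<Sum>s\<in>A. \<Sum>t\<in>A. D s t) = 0"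
    by (intro sum.neutral ballI) (auto simp: A_def D_def)
  have "2 * V = (\<Sum>s\<in>S. \<Sum>t\<in>S. D s t)"
    unfolding D_def V_def by (rule double_sum_diff_squares[symmetric])
  also have "\<dots> = 2 * x + y"
    by (simp add: split sum.distrib AA sym flip: x_def y_def)
  finally have V: "2 * V = 2 * x + y" .
  have y0: "y \<ge> 0"
    unfolding y_def D_def by (intro sum_nonneg) auto
  have D1: "D s t > 0" if "s \<in> A" "t \<in> B" for s t
    using that by (auto simp: A_def B_def D_def)
  have x_eq: "x = int (card A) * int (card B) + (\<Sum>s\<in>A. \<Sum>t\<in>B. D s t - 1)"
    by (simp add: x_def sum_subtractf)
  have x0: "(\<Sum>s\<in>A. \<Sum>t\<in>B. D s t - 1) \<ge> 0"
    by (intro sum_nonneg) (use D1 in auto)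
  have cA: "card A \<ge> 1" and cB: "card B \<ge> 1"
    using s1 s2 fin by (auto simp: A_def B_def Suc_le_eq card_gt_0_iff)
  have card: "int (card S) = int (card A) + int (card B)"
    using S fin by (simp add: card_Un_disjoint)
  have AB: "int (card A) * int (card B) \<ge> int (card S) - 1"
    using mult_ge_add_minus_one(1)[of "int (card A)" "int (card B)"] cA cB card by simp
  show "V \<ge> int (card S) - 1"
    using V x_eq x0 y0 AB by linarith
  assume Veq: "V = int (card S) - 1"
  then have "int (card A) * int (card B) = int (card S) - 1" and y: "y = 0"
    and x: "(\<Sum>s\<in>A. \<Sum>t\<in>B. D s t - 1) = 0"
    using V x_eq x0 y0 AB by linarith+
  then have "card A = 1 \<or> card B = 1"
    using mult_ge_add_minus_one(2)[of "int (card A)" "int (card B)"] cA cB card by simp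
  have Dx: "D s t = 1" if "s \<in> A" "t \<in> B" for s t
  proof -
    have "(\<Sum>t\<in>B. D s t - 1) = 0"
      by (rule sum_nonneg_0[OF fin(1) _ x that(1)]) (use D1 in \<open>auto intro!: sum_nonneg\<close>)
    then have "D s t - 1 = 0"
      by (rule sum_nonneg_0[OF fin(2) _ _ that(2), rotated]) (use D1 that(1) in auto)
    then show ?thesis
      by simp
  qed
  have By: "v s = v t" if "s \<in> B" "t \<in> B" for s t
  proof -
    have "(\<Sum>t\<in>B. D s t) = 0"
      by (rule sum_nonneg_0[OF fin(2) _ y[unfolded y_def] that(1)]) (auto simp: D_def intro: sum_nonneg)
    then have "D s t = 0"
      by (rule sum_nonneg_0[OF fin(2) _ _ that(2), rotated]) (simp add: D_def)
    then show ?thesis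
      by (simp add: D_def)
  qed
  have s12: "s1 \<in> A" "s2 \<in> B"
    using s1 s2 by (auto simp: A_def B_def)
  have e: "v s1 - v s2 = 1 \<or> v s1 - v s2 = -1"
    using Dx[OF s12] by (simp add: D_def power2_eq_1_iff)
  show "\<exists>s0\<in>S. \<exists>a e. (e = 1 \<or> e = -1) \<and> (\<forall>s\<in>S. v s = a + (if s = s0 then e else 0))"
    using \<open>card A = 1 \<or> card B = 1\<close>
  proof
    assume "card A = 1"
    then have "A = {s1}"
      using s12 by (auto simp: card_1_singleton_iff)
    then have "\<forall>s\<in>S. v s = v s2 + (if s = s1 then v s1 - v s2 else 0)"
      using By[OF _ s12(2)] S by auto
    then show ?thesis
      using e s1 by blast
  next
    assume "card B = 1"
    then have "B = {s2}"
      using s12 by (auto simp: card_1_singleton_iff)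
    then have "\<forall>s\<in>S. v s = v s1 + (if s = s2 then v s2 - v s1 else 0)"
      unfolding A_def B_def by auto
    moreover have "v s2 - v s1 = 1 \<or> v s2 - v s1 = -1"
      using e by linarith
    ultimately show ?thesis
      using s2 by blast
  qed
qed

context prime_power_unity_root
begin

lemma sum_by_residue:
  fixes W :: "'a \<Rightarrow> int"
  assumes "finite X"
  shows "(\<Sum>x\<in>X. of_int (W x) * w ^ e x) =
    (\<Sum>l<p * q. of_int (\<Sum>x | x \<in> X \<and> e x mod (p * q) = l. W x) * w ^ l)"
proof -
  have "(\<Sum>x\<in>X. of_int (W x) * w ^ e x) =
      (\<Sum>l<p * q. \<Sum>x | x \<in> X \<and> e x mod (p * q) = l. of_int (W x) * w ^ e x)"
    using assms by (intro sum.group[symmetric]) auto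
  also have "\<dots> = (\<Sum>l<p * q. \<Sum>x | x \<in> X \<and> e x mod (p * q) = l. of_int (W x) * w ^ l)"
    by (intro sum.cong refl) (metis (mono_tags, lifting) mem_Collect_eq w_pow_mod)
  finally show ?thesis
    by (simp add: sum_distrib_right)
qed

lemma ipoly_rep: "\<exists>c. ipoly f w = (\<Sum>l<p * q. of_int (c l) * w ^ l)"
proof -
  have "ipoly f w = (\<Sum>i\<le>degree f. of_int (coeff f i) * w ^ i)"
    by (subst poly_as_sum_of_monoms[symmetric]) simp
  then show ?thesis
    using sum_by_residue[of "{..degree f}" "coeff f" "\<lambda>i. i"]
    by (intro exI[of _ "\<lambda>l. \<Sum>i | i \<in> {..degree f} \<and> i mod (p * q) = l. coeff f i"]) simp
qed

lemma sum_powers_q: "(\<Sum>s<p. (w ^ q) ^ s) = 0"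
  using ipoly_cyclo by (simp add: cyclo_def power_mult)

text \<open>
  This is the trace of the assumption, from the field of \<open>w\<close> to the rationals, divided by \<open>q\<close>: the
  trace of \<open>w\<^bsup>e\<^esup>\<close> is \<open>q\<close> times \<open>p [pq dvd e] - [q dvd e]\<close>. The uniqueness of integer relations
  takes the place of the Galois group.
\<close>

lemma trace_identity:
  fixes W :: "'a \<Rightarrow> int"
  assumes "finite X" and eq: "(\<Sum>x\<in>X. of_int (W x) * w ^ e x) = of_int b"
  shows "int p * (\<Sum>x | x \<in> X \<and> p * q dvd e x. W x) =
    (\<Sum>x | x \<in> X \<and> q dvd e x. W x) + (int p - 1) * b"
proof -
  define d where "d l = (\<Sum>x | x \<in> X \<and> e x mod (p * q) = l. W x)" for l
  \<comment> \<open>correcting the coefficient of \<open>w ^ 0\<close> by \<open>b\<close> turns the equation into a relation with value 0\<close>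
  define d' where "d' l = d l - (if l = 0 then b else 0)" for l
  have "(\<Sum>l<p * q. of_int (d' l) * w ^ l) =
      (\<Sum>l<p * q. of_int (d l) * w ^ l - (if l = 0 then of_int b else 0))"
    by (intro sum.cong refl) (auto simp: d'_def)
  also have "\<dots> = (\<Sum>l<p * q. of_int (d l) * w ^ l) - (\<Sum>l<p * q. if l = 0 then of_int b else 0)"
    by (rule sum_subtractf)
  also have "\<dots> = 0"
    using eq sum_by_residue[OF assms(1), of W e] by (simp add: d_def)
  finally have zero: "(\<Sum>l<p * q. of_int (d' l) * w ^ l) = 0" .
  have const: "d' (q * s) = d' 0" if "s < p" for s
    using coeffs_periodic[OF zero, of 0 s] that by simp
  have "(\<Sum>x | x \<in> X \<and> q dvd e x. W x) =
      (\<Sum>s<p. \<Sum>x | x \<in> {x \<in> X. q dvd e x} \<and> e x mod (p * q) div q = s. W x)"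
    using assms(1) by (intro sum.group[symmetric]) (auto simp: less_mult_imp_div_less)
  also have "\<dots> = (\<Sum>s<p. d (q * s))"
  proof (intro sum.cong refl)
    fix s assume "s \<in> {..<p}"
    have "e x mod (p * q) = q * s \<longleftrightarrow> q dvd e x \<and> e x mod (p * q) div q = s" for x
    proof
      assume *: "e x mod (p * q) = q * s"
      then have "q dvd e x"
        by (metis dvd_mod_iff dvd_triv_left dvd_triv_right)
      then show "q dvd e x \<and> e x mod (p * q) div q = s"
        using * by simp
    next
      assume *: "q dvd e x \<and> e x mod (p * q) div q = s"
      then have "q dvd e x mod (p * q)"
        by (simp add: dvd_mod)
      then show "e x mod (p * q) = q * s"
        using * by auto
    qed
    then show "(\<Sum>x | x \<in> {x \<in> X. q dvd e x} \<and> e x mod (p * q) div q = s. W x) = d (q * s)"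
      unfolding d_def by (intro sum.cong) auto
  qed
  also have "\<dots> = (\<Sum>s<p. d' (q * s) + (if s = 0 then b else 0))"
    by (intro sum.cong refl) (auto simp: d'_def)
  also have "\<dots> = (\<Sum>s<p. d' (q * s)) + (\<Sum>s<p. if s = 0 then b else 0)"
    by (rule sum.distrib)
  also have "\<dots> = int p * (d 0 - b) + b"
    using const by (simp add: d'_def)
  also have "d 0 = (\<Sum>x | x \<in> X \<and> p * q dvd e x. W x)"
    by (simp add: d_def mod_eq_0_iff_dvd)
  finally show ?thesis
    by (simp add: algebra_simps)
qed

lemma dvd_reflect_iff:
  assumes "r dvd p * q" "i < p * q" "j < p * q"
  shows "r dvd i + (p * q - 1) * j \<longleftrightarrow> i mod r = j mod r"
proof -
  have "p * q = Suc (p * q - 1)"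
    by simp
  then have "int (p * q) = int (p * q - 1) + 1"
    by (metis Suc_eq_plus1 of_nat_1 of_nat_add)
  then have "int (i + (p * q - 1) * j) = (int i - int j) + int (p * q) * int j"
    by (simp only: of_nat_add of_nat_mult distrib_right mult_1)
  moreover have "int r dvd int (p * q) * int j"
    using assms(1) by (meson dvd_mult2 int_dvd_int_iff)
  ultimately have "int r dvd int (i + (p * q - 1) * j) \<longleftrightarrow> int r dvd int i - int j"
    by (simp only: dvd_add_left_iff)
  then show ?thesis
    by (simp only: int_dvd_int_iff mod_eq_dvd_iff[symmetric] zmod_int[symmetric] of_nat_eq_iff)
qed

text \<open>
  The trace identity for the expansion of \<open>g * cnj g\<close>. The pairs with equal indices give the sum of
  squares, the pairs congruent modulo \<open>q\<close> give the squares of the block sums.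
\<close>

lemma norm_one_variance:
  assumes c: "g = (\<Sum>l<p * q. of_int (c l) * w ^ l)" and "g * cnj g = 1"
  shows "(\<Sum>j<q. int p * (\<Sum>s<p. c (j + q * s) ^ 2) - (\<Sum>s<p. c (j + q * s)) ^ 2) = int p - 1"
proof -
  let ?N = "p * q"
  \<comment> \<open>conjugation negates exponents, so the pair \<open>(i, j)\<close> carries the exponent \<open>i - j\<close>, taken modulo the order\<close>
  let ?X = "{..<?N} \<times> {..<?N}"
  let ?W = "\<lambda>(i, j). c i * c j" and ?e = "\<lambda>(i, j). i + (?N - 1) * j"
  have "g * cnj g = (\<Sum>i<?N. of_int (c i) * w ^ i) * (\<Sum>j<?N. of_int (c j) * w ^ ((?N - 1) * j))"
    unfolding c by (simp add: cnj_w power_mult)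
  also have "\<dots> = (\<Sum>x\<in>?X. of_int (?W x) * w ^ ?e x)"
    by (auto simp: sum_product sum.cartesian_product power_add mult_ac intro!: sum.cong)
  finally have "(\<Sum>x\<in>?X. of_int (?W x) * w ^ ?e x) = of_int 1"
    using assms(2) by simp
  then have tr: "int p * (\<Sum>x | x \<in> ?X \<and> ?N dvd ?e x. ?W x) =
      (\<Sum>x | x \<in> ?X \<and> q dvd ?e x. ?W x) + (int p - 1) * 1"
    by (intro trace_identity) auto
  have "{x. x \<in> ?X \<and> ?N dvd ?e x} = (\<lambda>i. (i, i)) ` {..<?N}"
    by (auto simp: dvd_reflect_iff simp del: One_nat_def)
  then have 1: "(\<Sum>x | x \<in> ?X \<and> ?N dvd ?e x. ?W x) = (\<Sum>i<?N. c i ^ 2)"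
    by (simp add: sum.reindex inj_on_def power2_eq_square)
  have "(\<Sum>x | x \<in> ?X \<and> q dvd ?e x. ?W x) = (\<Sum>i<?N. \<Sum>j<?N. if i mod q = j mod q then c i * c j else 0)"
  proof -
    have "{x. x \<in> ?X \<and> q dvd ?e x} = {x \<in> ?X. fst x mod q = snd x mod q}"
      by (auto simp: dvd_reflect_iff simp del: One_nat_def)
    then show ?thesis
      by (simp add: sum.cartesian_product sum.inter_filter case_prod_unfold)
  qed
  also have "\<dots> = (\<Sum>j<q. \<Sum>s<p. \<Sum>j'<q. \<Sum>s'<p. if j = j' then c (j + q * s) * c (j' + q * s') else 0)"
    unfolding sum_lessThan_mult by (intro sum.cong refl) (auto simp: mod_mult_self2)
  also have "\<dots> = (\<Sum>j<q. \<Sum>s<p. \<Sum>j'<q. if j = j' then (\<Sum>s'<p. c (j + q * s) * c (j' + q * s')) else 0)"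
    by (intro sum.cong refl) auto
  also have "\<dots> = (\<Sum>j<q. (\<Sum>s<p. c (j + q * s)) ^ 2)"
    by (simp add: power2_eq_square sum_product)
  finally have 2: "(\<Sum>x | x \<in> ?X \<and> q dvd ?e x. ?W x) = (\<Sum>j<q. (\<Sum>s<p. c (j + q * s)) ^ 2)" .
  show ?thesis
    using tr unfolding 1 2 by (simp add: sum_lessThan_mult sum_subtractf sum_distrib_left)
qed

text \<open>
  The block variances are nonnegative integers with sum \<open>p - 1\<close>, and a nonconstant block already
  contributes at least \<open>p - 1\<close>. Constant blocks contribute nothing to the element, because the sum of
  all \<open>p\<close>-th roots of unity is 0. So there is exactly one nonconstant block, and it is extremal: constant
  except for one coefficient that is larger or smaller by 1.
\<close>

lemma norm_one_imp_root_of_unity: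
  assumes "ipoly f w * cnj (ipoly f w) = 1"
  shows "\<exists>l. ipoly f w = w ^ l \<or> ipoly f w = - (w ^ l)"
proof -
  obtain c where c: "ipoly f w = (\<Sum>l<p * q. of_int (c l) * w ^ l)"
    using ipoly_rep by blast
  define v where "v j s = c (j + q * s)" for j s
  define V where "V j = int p * (\<Sum>s<p. v j s ^ 2) - (\<Sum>s<p. v j s) ^ 2" for j
  have blocks: "ipoly f w = (\<Sum>j<q. w ^ j * (\<Sum>s<p. of_int (v j s) * (w ^ q) ^ s))"
    unfolding c sum_lessThan_mult v_def power_add power_mult sum_distrib_left
    by (intro sum.cong refl) (simp add: mult_ac)
  have sumV: "(\<Sum>j<q. V j) = int p - 1"
    unfolding V_def v_def by (rule norm_one_variance[OF c assms])
  have const: "(\<Sum>s<p. of_int (v j s) * (w ^ q) ^ s) = 0" if "\<And>s. s < p \<Longrightarrow> v j s = v j 0" for j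
  proof -
    have "(\<Sum>s<p. of_int (v j s) * (w ^ q) ^ s) = of_int (v j 0) * (\<Sum>s<p. (w ^ q) ^ s)"
      unfolding sum_distrib_left by (intro sum.cong refl) (metis lessThan_iff that)
    then show ?thesis
      by (simp add: sum_powers_q)
  qed
  have nonconst: "V j \<ge> int p - 1" if "s < p" "v j s \<noteq> v j 0" for j s
    using nonconstant_variance(1)[of "{..<p}" 0 s "v j"] that by (simp add: V_def)
  have Vnonneg: "V j \<ge> 0" for j
  proof (cases "\<forall>s<p. v j s = v j 0")
    case True
    then have "(\<Sum>s<p. v j s ^ 2) = (\<Sum>s<p. v j 0 ^ 2)" "(\<Sum>s<p. v j s) = (\<Sum>s<p. v j 0)"
      by (metis (no_types, lifting) lessThan_iff sum.cong)+
    then show ?thesis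
      by (simp add: V_def power2_eq_square)
  next
    case False
    then show ?thesis
      using nonconst p_gt_1 by fastforce
  qed
  have "\<exists>j0<q. \<exists>s<p. v j0 s \<noteq> v j0 0"
  proof (rule ccontr)
    assume *: "\<not> ?thesis"
    have "ipoly f w = 0"
      unfolding blocks
    proof (intro sum.neutral ballI)
      fix j assume "j \<in> {..<q}"
      then have "(\<Sum>s<p. of_int (v j s) * (w ^ q) ^ s) = 0"
        by (intro const) (use * in blast)
      then show "w ^ j * (\<Sum>s<p. of_int (v j s) * (w ^ q) ^ s) = 0"
        by simp
    qed
    then show False
      using assms by simp
  qed
  then obtain j0 s1 where j0: "j0 < q" and s1: "s1 < p" "v j0 s1 \<noteq> v j0 0"
    by blast
  have split: "(\<Sum>j<q. V j) = V j0 + (\<Sum>j\<in>{..<q} - {j0}. V j)"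
    using j0 by (intro sum.remove) auto
  have "(\<Sum>j\<in>{..<q} - {j0}. V j) \<ge> 0"
    by (intro sum_nonneg Vnonneg)
  then have V0: "V j0 = int p - 1" and rest: "(\<Sum>j\<in>{..<q} - {j0}. V j) = 0"
    using sumV split nonconst[OF s1] by linarith+
  have others: "(\<Sum>s<p. of_int (v j s) * (w ^ q) ^ s) = 0" if "j < q" "j \<noteq> j0" for j
  proof (rule const, rule ccontr)
    fix s assume "s < p" "v j s \<noteq> v j 0"
    moreover have "V j = 0"
      by (rule sum_nonneg_0[OF _ _ rest]) (use that Vnonneg in auto)
    ultimately show False
      using nonconst p_gt_1 by fastforce
  qed
  obtain s0 a e where s0: "s0 < p" and e: "e = 1 \<or> e = -1"
    and spike: "\<And>s. s < p \<Longrightarrow> v j0 s = a + (if s = s0 then e else 0)"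
    using nonconstant_variance(2)[of "{..<p}" 0 s1 "v j0"] V0 s1 by (auto simp: V_def)
  have "(\<Sum>s<p. of_int (v j0 s) * (w ^ q) ^ s) =
      (\<Sum>s<p. of_int a * (w ^ q) ^ s + (if s = s0 then of_int e * (w ^ q) ^ s else 0))"
    by (intro sum.cong refl) (auto simp: spike algebra_simps)
  also have "\<dots> = of_int a * (\<Sum>s<p. (w ^ q) ^ s) + of_int e * (w ^ q) ^ s0"
    using s0 by (simp add: sum.distrib sum_distrib_left)
  also have "\<dots> = of_int e * (w ^ q) ^ s0"
    by (simp add: sum_powers_q)
  finally have "ipoly f w = (\<Sum>j<q. if j = j0 then w ^ j * (of_int e * (w ^ q) ^ s0) else 0)"
    unfolding blocks by (intro sum.cong refl) (auto simp: others)
  also have "\<dots> = of_int e * w ^ (j0 + q * s0)"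
    using j0 by (simp add: power_add power_mult)
  finally show ?thesis
    using e by auto
qed

section \<open>Numbers of absolute value a power of the square root of p\<close>

text \<open>
  The half product for the primitive \<open>p\<close>-th root of unity \<open>w\<^bsup>q\<^esup>\<close> (the instance \<open>m = 0\<close>) lies in
  \<open>\<int>[w\<^bsup>q\<^esup>]\<close>, and it is the square root up to sign and a power of \<open>w\<^bsup>q\<^esup>\<close>.
\<close>

lemma sqrt_pstar_in_subring:
  assumes "odd p"
  shows "\<exists>g. sqrt_pstar p = ipoly g (w ^ q)"
proof -
  interpret z: prime_power_unity_root p 0 "w ^ q"
    by (rule unity_root_power_q)
  obtain e where e: "z.half_prod = sqrt_pstar p * (w ^ q) ^ e \<or> z.half_prod = - (sqrt_pstar p * (w ^ q) ^ e)"
    using z.half_prod_eq[OF assms] by blast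
  define h where "h = z.conj_poly (monom 1 e) * (\<Prod>t\<in>z.half_totatives. 1 - monom 1 t)"
  have "ipoly (\<Prod>t\<in>A. 1 - monom 1 t) (w ^ q) = (\<Prod>t\<in>A. 1 - (w ^ q) ^ t)" for A :: "nat set"
    by (induction A rule: infinite_finite_induct) simp_all
  then have "ipoly h (w ^ q) = cnj ((w ^ q) ^ e) * z.half_prod"
    unfolding h_def ipoly_mult z.ipoly_conj_poly by (simp add: z.half_prod_def)
  moreover have "sqrt_pstar p * (w ^ q) ^ e * cnj ((w ^ q) ^ e) = sqrt_pstar p"
    unfolding mult.assoc z.w_pow_mult_cnj by simp
  ultimately have "sqrt_pstar p = ipoly h (w ^ q) \<or> sqrt_pstar p = ipoly (- h) (w ^ q)"
    using e by (auto simp: mult_ac)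
  then show ?thesis
    by blast
qed

text \<open>
  The powers of \<open>w\<close> with exponents below \<open>q\<close> are linearly independent over \<open>\<int>[w\<^bsup>q\<^esup>]\<close>: by the
  periodicity of integer relations every \<open>T j\<close> is a multiple of the sum of all \<open>p\<close>-th roots of
  unity.
\<close>

lemma block_coefficients_unique:
  assumes "\<And>j. j < q \<Longrightarrow> \<exists>g. T j = ipoly g (w ^ q)" and sum0: "(\<Sum>j<q. w ^ j * T j) = 0" and "j < q"
  shows "T j = 0"
proof -
  interpret z: prime_power_unity_root p 0 "w ^ q"
    by (rule unity_root_power_q)
  have "\<exists>b. T j = (\<Sum>s<p. of_int (b s) * (w ^ q) ^ s)" if "j < q" for j
    using assms(1)[OF that] z.ipoly_rep by (auto simp: z.q_def)
  then obtain b where b: "\<And>j. j < q \<Longrightarrow> T j = (\<Sum>s<p. of_int (b j s) * (w ^ q) ^ s)"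
    by metis
  \<comment> \<open>the coefficients of the blocks, listed by the exponent \<open>l = j + q * s\<close> of \<open>w\<close>\<close>
  define d where "d l = b (l mod q) (l div q)" for l
  have d: "d (j + q * s) = b j s" if "j < q" for j s
    using that by (simp add: d_def)
  have "(\<Sum>l<p * q. of_int (d l) * w ^ l) = (\<Sum>j<q. w ^ j * T j)"
    unfolding sum_lessThan_mult
  proof (intro sum.cong refl)
    fix j assume "j \<in> {..<q}"
    then have "j < q" by simp
    then show "(\<Sum>s<p. of_int (d (j + q * s)) * w ^ (j + q * s)) = w ^ j * T j"
      unfolding b[OF \<open>j < q\<close>] d[OF \<open>j < q\<close>] sum_distrib_left power_add power_mult
      by (intro sum.cong refl) (simp add: mult_ac)
  qed
  then have zero: "(\<Sum>l<p * q. of_int (d l) * w ^ l) = 0"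
    using sum0 by simp
  have "b j s = b j 0" if "s < p" for s
    using coeffs_periodic[OF zero \<open>j < q\<close> that] d[OF \<open>j < q\<close>, of s] d[OF \<open>j < q\<close>, of 0] by simp
  then have "T j = (\<Sum>s<p. of_int (b j 0) * (w ^ q) ^ s)"
    unfolding b[OF \<open>j < q\<close>] by (intro sum.cong refl) (metis lessThan_iff)
  then show ?thesis
    by (simp add: sum_powers_q flip: sum_distrib_left)
qed

text \<open>
  Splitting off the half product \<open>n\<close> times leaves an element of absolute value 1, hence a root of
  unity up to sign. So \<open>\<alpha>\<close> is, up to sign, a power of \<open>w\<close> times \<open>sqrt_pstar p ^ n\<close>. Writing the
  exponent as \<open>j0 + q * s0\<close> exhibits \<open>\<alpha>\<close> as a combination with the single block \<open>j0\<close>, and the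
  blocks are unique.
\<close>

lemma single_block:
  assumes "odd p" and T: "\<And>j. j < q \<Longrightarrow> \<exists>g. T j = ipoly g (w ^ q)"
    and \<alpha>: "\<alpha> = (\<Sum>j<q. w ^ j * T j)" "\<alpha> * cnj \<alpha> = of_nat p ^ n"
  obtains j0 s0 e where "j0 < q" "s0 < p" "e = 1 \<or> e = -1"
    "\<And>j. j < q \<Longrightarrow> T j = (if j = j0 then e * (w ^ q) ^ s0 * sqrt_pstar p ^ n else 0)"
proof -
  obtain g where g: "\<And>j. j < q \<Longrightarrow> T j = ipoly (g j) (w ^ q)"
    using T by metis
  define f where "f = (\<Sum>j<q. monom 1 j * pcompose (g j) (monom 1 q))"
  have \<alpha>f: "\<alpha> = ipoly f w"
    by (simp add: \<alpha>(1) f_def g)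
  obtain h where h: "ipoly f w = half_prod ^ n * ipoly h w" "ipoly h w * cnj (ipoly h w) = 1"
    using split_off_half_prod_power[OF assms(1), of f n] \<alpha>(2) \<alpha>f by auto
  obtain l where l: "ipoly h w = w ^ l \<or> ipoly h w = - (w ^ l)"
    using norm_one_imp_root_of_unity[OF h(2)] by blast
  obtain e where e: "half_prod = sqrt_pstar p * w ^ e \<or> half_prod = - (sqrt_pstar p * w ^ e)"
    using half_prod_eq[OF assms(1)] by blast
  have "half_prod ^ n = sqrt_pstar p ^ n * w ^ (e * n) \<or> half_prod ^ n = - (sqrt_pstar p ^ n * w ^ (e * n))"
    using e by (cases "even n") (auto simp: power_mult_distrib power_mult)
  then have "\<exists>\<epsilon>. (\<epsilon> = 1 \<or> \<epsilon> = -1) \<and> \<alpha> = \<epsilon> * w ^ (e * n + l) * sqrt_pstar p ^ n"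
    unfolding \<alpha>f h(1) using l by (auto simp: power_add)
  then obtain \<epsilon> where \<epsilon>: "\<epsilon> = 1 \<or> \<epsilon> = -1" "\<alpha> = \<epsilon> * w ^ (e * n + l) * sqrt_pstar p ^ n"
    by blast
  define r where "r = (e * n + l) mod (p * q)"
  define j0 where "j0 = r mod q"
  define s0 where "s0 = r div q"
  have j0: "j0 < q"
    by (simp add: j0_def)
  have s0: "s0 < p"
    by (simp add: s0_def r_def less_mult_imp_div_less)
  have "w ^ (e * n + l) = w ^ (j0 + q * s0)"
    by (simp add: j0_def s0_def r_def)
  then have \<alpha>': "\<alpha> = w ^ j0 * (\<epsilon> * (w ^ q) ^ s0 * sqrt_pstar p ^ n)"
    unfolding \<epsilon>(2) by (simp add: power_add power_mult)
  define T0 where "T0 = \<epsilon> * (w ^ q) ^ s0 * sqrt_pstar p ^ n"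
  obtain gs where gs: "sqrt_pstar p = ipoly gs (w ^ q)"
    using sqrt_pstar_in_subring[OF assms(1)] by blast
  obtain g\<epsilon> where g\<epsilon>: "\<epsilon> = ipoly g\<epsilon> (w ^ q)"
    using \<epsilon>(1) ipoly_1[of "w ^ q"] ipoly_minus[of 1 "w ^ q"] by metis
  have T0: "T0 = ipoly (g\<epsilon> * monom 1 s0 * gs ^ n) (w ^ q)"
    unfolding T0_def by (simp add: gs flip: g\<epsilon>)
  define D where "D j = T j - (if j = j0 then T0 else 0)" for j
  have "D j = 0" if "j < q" for j
  proof (rule block_coefficients_unique[OF _ _ that])
    fix j assume "j < q"
    then have "D j = ipoly (g j - (if j = j0 then g\<epsilon> * monom 1 s0 * gs ^ n else 0)) (w ^ q)"
      using T0 by (simp add: D_def g)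
    then show "\<exists>g. D j = ipoly g (w ^ q)"
      by blast
  next
    have "(\<Sum>j<q. w ^ j * D j) = (\<Sum>j<q. w ^ j * T j - (if j = j0 then w ^ j * T0 else 0))"
      by (intro sum.cong refl) (simp add: D_def algebra_simps)
    also have "\<dots> = \<alpha> - w ^ j0 * T0"
      using j0 by (simp add: sum_subtractf \<alpha>(1))
    also have "\<dots> = 0"
      using \<alpha>' by (simp add: T0_def)
    finally show "(\<Sum>j<q. w ^ j * D j) = 0" .
  qed
  then have "T j = (if j = j0 then \<epsilon> * (w ^ q) ^ s0 * sqrt_pstar p ^ n else 0)" if "j < q" for j
    using that by (metis D_def T0_def right_minus_eq)
  then show ?thesis
    using that j0 s0 \<epsilon>(1) by blast
qed

end

section \<open>Sums over residue vectors\<close>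

lemma Zvec_0: "Zvec p 0 = {[]}"
  by (auto simp: Zvec_def)

lemma Zvec_Suc: "Zvec p (Suc n) = (\<lambda>(t, x). t # x) ` (Zmod p \<times> Zvec p n)"
  by (auto simp: Zvec_def length_Suc_conv image_iff)

lemma finite_Zmod [simp]: "finite (Zmod p)"
  by (simp add: Zmod_def)

lemma finite_Zvec [simp]: "finite (Zvec p n)"
  by (induction n) (simp_all add: Zvec_0 Zvec_Suc)

lemma Zvec_append: "Zvec p (n + l) = (\<lambda>(x, y). x @ y) ` (Zvec p n \<times> Zvec p l)"
proof (intro equalityI subsetI)
  fix v assume v: "v \<in> Zvec p (n + l)"
  then have "take n v \<in> Zvec p n" "drop n v \<in> Zvec p l"
    by (auto simp: Zvec_def dest: in_set_takeD in_set_dropD)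
  then show "v \<in> (\<lambda>(x, y). x @ y) ` (Zvec p n \<times> Zvec p l)"
    by (intro image_eqI[of _ _ "(take n v, drop n v)"]) auto
qed (auto simp: Zvec_def)

lemma sum_Zvec_append:
  "(\<Sum>v\<in>Zvec p (n + l). g v) = (\<Sum>x\<in>Zvec p n. \<Sum>y\<in>Zvec p l. g (x @ y))"
proof -
  have "inj_on (\<lambda>(x, y). x @ y) (Zvec p n \<times> Zvec p l)"
    by (auto simp: inj_on_def Zvec_def)
  then show ?thesis
    unfolding Zvec_append by (simp add: sum.reindex sum.cartesian_product case_prod_unfold)
qed

lemma dot_append:
  assumes "length u = length x" "length z = length y"
  shows "dot (u @ z) (x @ y) = dot u x + dot z y"
proof -
  have *: "{..<length x + length y} = {..<length x} \<union> {length x..<length x + length y}"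
    by auto
  have "dot (u @ z) (x @ y) = (\<Sum>i<length x. (u @ z) ! i * (x @ y) ! i) +
      (\<Sum>i\<in>{length x..<length x + length y}. (u @ z) ! i * (x @ y) ! i)"
    unfolding dot_def length_append * by (rule sum.union_disjoint) auto
  also have "(\<Sum>i\<in>{length x..<length x + length y}. (u @ z) ! i * (x @ y) ! i) =
      (\<Sum>i<length y. (u @ z) ! (i + length x) * (x @ y) ! (i + length x))"
    using sum.shift_bounds_nat_ivl[of "\<lambda>i. (u @ z) ! i * (x @ y) ! i" 0 "length x" "length y"]
    by (simp add: lessThan_atLeast0 add.commute)
  finally show ?thesis
    using assms by (simp add: dot_def nth_append)
qed

lemma powi_mod:
  fixes z :: complex
  assumes "z ^ p = 1" "p > 0"
  shows "z powi i = z ^ nat (i mod int p)"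
proof -
  have nz: "z \<noteq> 0"
    using assms by (metis power_0_left zero_neq_one gr_implies_not0)
  have "z powi i = z powi (int p * (i div int p) + i mod int p)"
    by simp
  also have "\<dots> = (z powi int p) powi (i div int p) * z powi (i mod int p)"
    by (simp only: power_int_add[OF disjI1[OF nz]] power_int_mult)
  also have "z powi int p = 1"
    using assms by simp
  also have "z powi (i mod int p) = z ^ nat (i mod int p)"
    using assms(2) by (simp add: power_int_def)
  finally show ?thesis
    by simp
qed

lemma powi_cong:
  fixes z :: complex
  assumes "z ^ p = 1" "p > 0" "i mod int p = j mod int p"
  shows "z powi i = z powi j"
  using assms by (simp add: powi_mod)

lemma sum_Zmod_character:
  fixes z :: complex
  assumes "prime p" "z ^ p = 1" "z \<noteq> 1"
  shows "(\<Sum>t\<in>Zmod p. z powi (c * t)) = (if int p dvd c then of_nat p else 0)"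
proof -
  have p: "p > 0"
    using assms(1) prime_gt_0_nat by blast
  define y where "y = z powi c"
  have "Zmod p = int ` {..<p}"
    by (simp add: Zmod_def image_int_atLeastLessThan lessThan_atLeast0)
  then have "(\<Sum>t\<in>Zmod p. z powi (c * t)) = (\<Sum>t<p. y ^ t)"
    by (simp add: sum.reindex y_def power_int_mult)
  also have "\<dots> = (if int p dvd c then of_nat p else 0)"
  proof (cases "int p dvd c")
    case True
    then have "y = 1"
      using powi_cong[OF assms(2) p, of c 0] by (simp add: y_def)
    then show ?thesis
      using True by simp
  next
    case False
    have "y ^ p = z powi (c * int p)"
      by (simp add: y_def power_int_mult)
    also have "\<dots> = z powi 0"
      by (rule powi_cong[OF assms(2) p]) simp
    finally have yp: "y ^ p = 1"
      by simp
    have "y \<noteq> 1"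
    proof
      assume "y = 1"
      have "prime (int p)"
        using assms(1) by simp
      then have "coprime c (int p)"
        using False prime_imp_coprime coprime_commute by metis
      then obtain b where "[c * b = 1] (mod int p)"
        using cong_solve_coprime_int by blast
      then have "z powi (c * b) = z powi 1"
        by (intro powi_cong[OF assms(2) p]) (simp add: cong_def)
      then have "z = 1"
        using \<open>y = 1\<close> by (simp add: power_int_mult y_def)
      then show False
        using assms(3) by simp
    qed
    moreover have "(y - 1) * (\<Sum>t<p. y ^ t) = 0"
      using yp by (simp add: power_diff_1_eq[symmetric])
    ultimately show ?thesis
      using False by simp
  qed
  finally show ?thesis .
qed

lemma sum_Zvec_character:
  fixes z :: complex
  assumes "prime p" "z ^ p = 1" "z \<noteq> 1"
  shows "(\<Sum>y\<in>Zvec p l. z powi (\<Sum>i<l. c i * y ! i)) =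
    (if \<forall>i<l. int p dvd c i then of_nat p ^ l else 0)"
proof (induction l arbitrary: c)
  case 0
  then show ?case
    by (simp add: Zvec_0)
next
  case (Suc l)
  have nz: "z \<noteq> 0"
    using assms(2) prime_gt_0_nat[OF assms(1)] by (metis power_0_left zero_neq_one gr_implies_not0)
  have "(\<Sum>y\<in>Zvec p (Suc l). z powi (\<Sum>i<Suc l. c i * y ! i)) =
      (\<Sum>t\<in>Zmod p. \<Sum>y\<in>Zvec p l. z powi (c 0 * t) * z powi (\<Sum>i<l. c (Suc i) * y ! i))"
    using nz unfolding Zvec_Suc
    by (subst sum.reindex)
       (auto simp: inj_on_def sum.cartesian_product sum.lessThan_Suc_shift power_int_add case_prod_unfold
         simp del: sum.lessThan_Suc intro!: sum.cong)
  also have "\<dots> = (\<Sum>t\<in>Zmod p. z powi (c 0 * t)) * (\<Sum>y\<in>Zvec p l. z powi (\<Sum>i<l. c (Suc i) * y ! i))"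
    by (simp add: sum_product)
  also have "\<dots> = (if \<forall>i<Suc l. int p dvd c i then of_nat p ^ Suc l else 0)"
    unfolding Suc.IH sum_Zmod_character[OF assms] by (auto simp: less_Suc_eq_0_disj)
  finally show ?case .
qed

lemma zeta_mult_power:
  assumes "b > 0"
  shows "zeta (a * b) ^ b = zeta a"
  using assms by (simp add: zeta_def flip: exp_of_nat_mult)

lemma zeta_power_self:
  assumes "a > 0"
  shows "zeta a ^ a = 1"
  using zeta_mult_power[of a 1] assms by (simp add: zeta_def)

lemma zeta_neq_1:
  assumes "a > 1"
  shows "zeta a \<noteq> 1"
proof
  assume "zeta a = 1"
  have zeta: "zeta a = cis (2 * pi * real 1 / real a)"
    by (simp add: zeta_def cis_conv_exp mult_ac)
  have "inj_on (\<lambda>k. cis (2 * pi * real k / real a)) {..<a}"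
    using bij_betw_roots_unity[of a] assms by (simp add: bij_betw_def)
  then have "cis (2 * pi * real 1 / real a) = cis (2 * pi * real 0 / real a) \<Longrightarrow> (1 :: nat) = 0"
    by (rule inj_onD) (use assms in auto)
  then show False
    using \<open>zeta a = 1\<close> unfolding zeta by simp
qed

lemma sqrt_pstar_power:
  assumes "p > 0"
  shows "sqrt_pstar p ^ n = (if p mod 4 = 1 then 1 else \<i> ^ n) * of_real (real p powr (real n / 2))"
proof -
  have "sqrt p ^ n = real p powr (real n / 2)"
    using assms by (simp add: powr_half_sqrt[symmetric] powr_powr flip: powr_realpow)
  then show ?thesis
    by (simp add: sqrt_pstar_def power_mult_distrib flip: of_real_power)
qed

section \<open>The Walsh transform of the Gray image\<close>

lemma digit_sum_bounds:
  fixes c :: "nat \<Rightarrow> int"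
  assumes "p > 0" "\<And>i. i < l \<Longrightarrow> c i \<in> Zmod p"
  shows "(\<Sum>i<l. int p ^ i * c i) \<in> {0..<int p ^ l}"
  using assms(2)
proof (induction l)
  case (Suc l)
  have IH: "(\<Sum>i<l. int p ^ i * c i) \<in> {0..<int p ^ l}"
    using Suc by simp
  have c: "0 \<le> c l" "c l \<le> int p - 1"
    using Suc.prems[of l] by (auto simp: Zmod_def)
  have "int p ^ l * c l \<le> int p ^ l * (int p - 1)"
    using c by (intro mult_left_mono) auto
  moreover have "0 \<le> int p ^ l * c l"
    using c by simp
  ultimately show ?case
    using IH by (simp add: algebra_simps)
qed simp

lemma digit_sum_eq_iff:
  fixes c d :: "nat \<Rightarrow> int"
  assumes "p > 0" "\<And>i. i < l \<Longrightarrow> c i \<in> Zmod p" "\<And>i. i < l \<Longrightarrow> d i \<in> Zmod p"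
  shows "(\<Sum>i<l. int p ^ i * c i) = (\<Sum>i<l. int p ^ i * d i) \<longleftrightarrow> (\<forall>i<l. c i = d i)"
proof
  assume eq: "(\<Sum>i<l. int p ^ i * c i) = (\<Sum>i<l. int p ^ i * d i)"
  show "\<forall>i<l. c i = d i"
  proof (intro allI impI)
    fix i assume "i < l"
    then show "c i = d i"
      using digit_unique[of "int p" l c i] digit_unique[of "int p" l d i] assms eq
      by (simp add: Zmod_def)
  qed
qed simp

text \<open>
  The sum over the second argument of the Gray image is a complete character sum in each
  coordinate. It vanishes unless the digits \<open>a i x\<close> below the leading one agree with \<open>z\<close>.
\<close>

lemma walsh_gray_map:
  assumes "prime p"
    and a: "\<And>i x. i < Suc l \<Longrightarrow> x \<in> Zvec p n \<Longrightarrow> a i x \<in> Zmod p"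
    and f: "\<And>x. x \<in> Zvec p n \<Longrightarrow> f x = (\<Sum>i<Suc l. int p ^ i * a i x)"
    and u: "u \<in> Zvec p n" and z: "z \<in> Zvec p l"
  shows "walsh p (n + l) (gray_map p (Suc l) n f) (u @ z) =
    of_real (real p powr (- real (n + l) / 2)) * (of_nat p ^ l *
      (\<Sum>x | x \<in> Zvec p n \<and> (\<forall>i<l. a i x = z ! i). zeta p powi (a l x - dot u x)))"
proof -
  have p: "p > 0" "p > 1"
    using assms(1) prime_gt_0_nat prime_gt_1_nat by blast+
  have zp: "zeta p ^ p = 1" "zeta p \<noteq> 1"
    using p zeta_power_self zeta_neq_1 by auto
  have nz: "zeta p \<noteq> 0"
    by (simp add: zeta_def)
  have point: "zeta p powi (gray_map p (Suc l) n f (x @ y) - dot (u @ z) (x @ y)) =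
      zeta p powi (a l x - dot u x) * zeta p powi (\<Sum>i<l. (a i x - z ! i) * y ! i)"
    if x: "x \<in> Zvec p n" and y: "y \<in> Zvec p l" for x y
  proof -
    have len: "length x = n" "length y = l" "length u = n" "length z = l"
      using x y u z by (auto simp: Zvec_def)
    have "gray_map p (Suc l) n f (x @ y) = (a l x + (\<Sum>i<l. a i x * y ! i)) mod int p"
      using gray_map_append[of p "Suc l" a x f n y] p a x f len by simp
    moreover have "dot (u @ z) (x @ y) = dot u x + dot z y"
      using len by (intro dot_append) auto
    ultimately have "zeta p powi (gray_map p (Suc l) n f (x @ y) - dot (u @ z) (x @ y)) =
        zeta p powi (a l x + (\<Sum>i<l. a i x * y ! i) - (dot u x + dot z y))"
      by (intro powi_cong[OF zp(1) p(1)]) (simp add: mod_diff_left_eq)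
    also have "a l x + (\<Sum>i<l. a i x * y ! i) - (dot u x + dot z y) =
        (a l x - dot u x) + (\<Sum>i<l. (a i x - z ! i) * y ! i)"
      by (simp add: dot_def len left_diff_distrib sum_subtractf)
    finally show ?thesis
      using nz by (simp add: power_int_add)
  qed
  have "(\<Sum>v\<in>Zvec p (n + l). zeta p powi (gray_map p (Suc l) n f v - dot (u @ z) v)) =
      (\<Sum>x\<in>Zvec p n. \<Sum>y\<in>Zvec p l.
        zeta p powi (a l x - dot u x) * zeta p powi (\<Sum>i<l. (a i x - z ! i) * y ! i))"
    unfolding sum_Zvec_append by (intro sum.cong refl point)
  also have "\<dots> = (\<Sum>x\<in>Zvec p n. if \<forall>i<l. a i x = z ! i then of_nat p ^ l * zeta p powi (a l x - dot u x) else 0)"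
  proof (intro sum.cong refl)
    fix x assume x: "x \<in> Zvec p n"
    have "int p dvd a i x - z ! i \<longleftrightarrow> a i x = z ! i" if "i < l" for i
    proof -
      have "a i x \<in> Zmod p" "z ! i \<in> Zmod p"
        using a[of i x] x z that by (auto simp: Zvec_def)
      then show ?thesis
        by (auto simp: Zmod_def mod_eq_dvd_iff[symmetric])
    qed
    then show "(\<Sum>y\<in>Zvec p l. zeta p powi (a l x - dot u x) * zeta p powi (\<Sum>i<l. (a i x - z ! i) * y ! i)) =
        (if \<forall>i<l. a i x = z ! i then of_nat p ^ l * zeta p powi (a l x - dot u x) else 0)"
      unfolding sum_distrib_left[symmetric] sum_Zvec_character[OF assms(1) zp] by auto
  qed
  also have "\<dots> = of_nat p ^ l * (\<Sum>x | x \<in> Zvec p n \<and> (\<forall>i<l. a i x = z ! i). zeta p powi (a l x - dot u x))"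
    unfolding sum_distrib_left by (simp add: sum.inter_filter)
  finally show ?thesis
    by (simp add: walsh_def)
qed

text \<open>
  The lower digits of \<open>f x\<close> form a number \<open>j\<close> below \<open>p\<^bsup>l\<^esup>\<close>, and the leading digit only enters through a
  \<open>p\<close>-th root of unity. The inner sum is the one to which the transform of the Gray image reduces
  when \<open>j\<close> is the number with digits \<open>z\<close>.
\<close>

lemma gen_walsh_blocks:
  assumes "prime p"
    and a: "\<And>i x. i < Suc l \<Longrightarrow> x \<in> Zvec p n \<Longrightarrow> a i x \<in> Zmod p"
    and f: "\<And>x. x \<in> Zvec p n \<Longrightarrow> f x = (\<Sum>i<Suc l. int p ^ i * a i x)"
  shows "(\<Sum>x\<in>Zvec p n. zeta p powi (- dot u x) * zeta (p ^ Suc l) powi (f x)) =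
    (\<Sum>j<p ^ l. zeta (p ^ Suc l) ^ j *
      (\<Sum>x | x \<in> Zvec p n \<and> (\<Sum>i<l. int p ^ i * a i x) = int j. zeta p powi (a l x - dot u x)))"
proof -
  let ?w = "zeta (p ^ Suc l)" and ?low = "\<lambda>x. \<Sum>i<l. int p ^ i * a i x"
  have p: "p > 0"
    using assms(1) prime_gt_0_nat by blast
  have nz: "?w \<noteq> 0" "zeta p \<noteq> 0"
    by (simp_all add: zeta_def)
  have low: "?low x \<in> {0..<int p ^ l}" if "x \<in> Zvec p n" for x
    using a that p by (intro digit_sum_bounds) auto
  have wq: "?w powi (int (p ^ l)) = zeta p"
    unfolding power_int_of_nat using zeta_mult_power[of "p ^ l" p] p by simp
  have point: "zeta p powi (- dot u x) * ?w powi (f x) = ?w ^ nat (?low x) * zeta p powi (a l x - dot u x)"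
    if x: "x \<in> Zvec p n" for x
  proof -
    have "f x = ?low x + int (p ^ l) * a l x"
      using f[OF x] by simp
    then have "?w powi (f x) = ?w powi (?low x) * zeta p powi (a l x)"
      using nz by (simp only: power_int_add[OF disjI1[OF nz(1)]] power_int_mult wq)
    moreover have "?w powi (?low x) = ?w ^ nat (?low x)"
      using low[OF x] by (simp add: power_int_def)
    moreover have "zeta p powi (a l x - dot u x) = zeta p powi (- dot u x) * zeta p powi (a l x)"
      using nz by (simp flip: power_int_add)
    ultimately show ?thesis
      by simp
  qed
  have "(\<Sum>x\<in>Zvec p n. zeta p powi (- dot u x) * ?w powi (f x)) =
      (\<Sum>x\<in>Zvec p n. ?w ^ nat (?low x) * zeta p powi (a l x - dot u x))"
    by (intro sum.cong refl point)
  also have "\<dots> = (\<Sum>j<p ^ l. \<Sum>x | x \<in> Zvec p n \<and> nat (?low x) = j. ?w ^ nat (?low x) * zeta p powi (a l x - dot u x))"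
    using low by (intro sum.group[symmetric]) (auto simp: nat_less_iff)
  also have "\<dots> = (\<Sum>j<p ^ l. ?w ^ j * (\<Sum>x | x \<in> Zvec p n \<and> ?low x = int j. zeta p powi (a l x - dot u x)))"
  proof (intro sum.cong refl)
    fix j
    have "{x. x \<in> Zvec p n \<and> nat (?low x) = j} = {x. x \<in> Zvec p n \<and> ?low x = int j}"
      using low by fastforce
    then show "(\<Sum>x | x \<in> Zvec p n \<and> nat (?low x) = j. ?w ^ nat (?low x) * zeta p powi (a l x - dot u x)) =
        ?w ^ j * (\<Sum>x | x \<in> Zvec p n \<and> ?low x = int j. zeta p powi (a l x - dot u x))"
      by (simp add: sum_distrib_left)
  qed
  finally show ?thesis .
qed

lemma prime_power_unity_root_zeta:
  assumes "prime p"
  shows "prime_power_unity_root p l (zeta (p ^ Suc l))"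
proof
  have p: "p > 0" "p > 1"
    using assms prime_gt_0_nat prime_gt_1_nat by blast+
  show "zeta (p ^ Suc l) ^ (p ^ Suc l) = 1"
    using p by (intro zeta_power_self) simp
  show "zeta (p ^ Suc l) ^ (p ^ l) \<noteq> 1"
    using zeta_mult_power[of "p ^ l" p] p zeta_neq_1[of p] by simp
qed fact

lemma plateaued_scaling:
  assumes "p > 0"
  shows "real p powr (- real (n + l) / 2) * (real p ^ l * real p powr (real n / 2)) = real p powr (real l / 2)"
proof -
  have "real p powr (- real (n + l) / 2) * (real p ^ l * real p powr (real n / 2)) =
      real p powr (- real (n + l) / 2 + (real l + real n / 2))"
    using assms by (simp add: powr_add powr_realpow)
  also have "- real (n + l) / 2 + (real l + real n / 2) = real l / 2"
    by (simp add: field_simps)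
  finally show ?thesis .
qed

text \<open>
  The uniform form of the result: the unit \<open>\<eta>\<close> is \<open>sqrt_pstar p ^ n\<close> divided by its absolute value.
  It is \<open>\<plusminus>1\<close> if \<open>n\<close> is even or \<open>p\<close> is 1 modulo 4, and \<open>\<plusminus>\<i>\<close> otherwise.
\<close>

lemma walsh_gray_map_values:
  assumes "prime p" "odd p" and gbent: "gbent p (Suc l) n f"
    and a: "\<And>i x. i < Suc l \<Longrightarrow> x \<in> Zvec p n \<Longrightarrow> a i x \<in> Zmod p"
    and f: "\<And>x. x \<in> Zvec p n \<Longrightarrow> f x = (\<Sum>i<Suc l. int p ^ i * a i x)"
    and u: "u \<in> Zvec p n" and z: "z \<in> Zvec p l"
  defines "\<eta> \<equiv> (if p mod 4 = 1 then 1 else \<i> ^ n)"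
  shows "\<exists>c\<in>Zmod p. walsh p (n + l) (gray_map p (Suc l) n f) (u @ z) \<in>
    {0, \<eta> * zeta p powi c * of_real (real p powr (real l / 2)),
     - (\<eta> * zeta p powi c * of_real (real p powr (real l / 2)))}"
proof -
  let ?w = "zeta (p ^ Suc l)"
  interpret prime_power_unity_root p l ?w
    by (rule prime_power_unity_root_zeta) fact
  have wq: "?w ^ q = zeta p"
    using zeta_mult_power[of "p ^ l" p] by (simp add: q_def)
  define T where "T j = (\<Sum>x | x \<in> Zvec p n \<and> (\<Sum>i<l. int p ^ i * a i x) = int j. zeta p powi (a l x - dot u x))" for j
  define \<alpha> where "\<alpha> = (\<Sum>x\<in>Zvec p n. zeta p powi (- dot u x) * ?w powi (f x))"
  have \<alpha>: "\<alpha> = (\<Sum>j<q. ?w ^ j * T j)"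
    unfolding \<alpha>_def T_def q_def by (rule gen_walsh_blocks[OF assms(1) a f])
  have T: "\<exists>g. T j = ipoly g (?w ^ q)" for j
  proof -
    have "T j = (\<Sum>x | x \<in> Zvec p n \<and> (\<Sum>i<l. int p ^ i * a i x) = int j. zeta p ^ nat ((a l x - dot u x) mod int p))"
      unfolding T_def by (intro sum.cong refl powi_mod zeta_power_self) simp_all
    also have "\<dots> = ipoly (\<Sum>x | x \<in> Zvec p n \<and> (\<Sum>i<l. int p ^ i * a i x) = int j.
        monom 1 (nat ((a l x - dot u x) mod int p))) (?w ^ q)"
      by (simp only: ipoly_sum ipoly_monom wq of_int_1 mult_1)
    finally show ?thesis
      by blast
  qed
  have "norm (gen_walsh p (Suc l) n f u) = 1"
    using gbent u by (simp add: gbent_def)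
  then have "real p powr (- real n / 2) * norm \<alpha> = 1"
    by (simp add: gen_walsh_def \<alpha>_def norm_mult)
  then have "norm \<alpha> = real p powr (real n / 2)"
    by (simp add: powr_minus field_simps)
  then have "norm \<alpha> ^ 2 = real p ^ n"
    by (simp add: powr_realpow[symmetric] powr_powr flip: powr_numeral)
  then have norm: "\<alpha> * cnj \<alpha> = of_nat p ^ n"
    unfolding complex_norm_square[symmetric] by simp
  obtain j0 s0 e where s0: "s0 < p" and e: "e = 1 \<or> e = -1"
    and single: "\<And>j. j < q \<Longrightarrow> T j = (if j = j0 then e * (?w ^ q) ^ s0 * sqrt_pstar p ^ n else 0)"
    by (rule single_block[OF assms(2) T \<alpha> norm]) blast
  define J where "J = nat (\<Sum>i<l. int p ^ i * z ! i)"
  have zi: "z ! i \<in> Zmod p" if "i < l" for i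
    using z that by (auto simp: Zvec_def)
  have Jb: "(\<Sum>i<l. int p ^ i * z ! i) \<in> {0..<int p ^ l}"
    by (rule digit_sum_bounds) (use zi in auto)
  then have J: "J < q" "int J = (\<Sum>i<l. int p ^ i * z ! i)"
    by (auto simp: J_def q_def nat_less_iff)
  have "T J = (\<Sum>x | x \<in> Zvec p n \<and> (\<forall>i<l. a i x = z ! i). zeta p powi (a l x - dot u x))"
    unfolding T_def J(2) by (intro sum.cong refl) (use digit_sum_eq_iff[of p l] a zi in auto)
  then have walsh: "walsh p (n + l) (gray_map p (Suc l) n f) (u @ z) =
      of_real (real p powr (- real (n + l) / 2)) * (of_nat p ^ l * T J)"
    using walsh_gray_map[OF assms(1) a f u z] by simp
  have "walsh p (n + l) (gray_map p (Suc l) n f) (u @ z) =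
      e * (\<eta> * zeta p powi int s0 * of_real (real p powr (real l / 2)))" if "T J \<noteq> 0"
  proof -
    have "T J = e * zeta p ^ s0 * (\<eta> * of_real (real p powr (real n / 2)))"
      using single[OF J(1), unfolded wq] that by (simp add: sqrt_pstar_power \<eta>_def split: if_splits)
    then have "walsh p (n + l) (gray_map p (Suc l) n f) (u @ z) = e * zeta p ^ s0 * \<eta> *
        of_real (real p powr (- real (n + l) / 2) * (real p ^ l * real p powr (real n / 2)))"
      unfolding walsh by (simp add: mult_ac)
    then show ?thesis
      unfolding plateaued_scaling[OF p_pos] by (simp add: mult_ac)
  qed
  then show ?thesis
    using e s0 walsh by (intro bexI[of _ "int s0"]) (auto simp: Zmod_def)
qed

theorem theorem5p2:
  fixes p n k :: nat and f :: "int list \<Rightarrow> int" and a :: "nat \<Rightarrow> int list \<Rightarrow> int"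
  assumes "prime p" and "odd p" and "n \<ge> 1" and "k \<ge> 1"
    and "gbent p k n f"
    and "\<And>i. i < k \<Longrightarrow> a i \<in> Zvec p n \<rightarrow> Zmod p"
    and "\<And>x. x \<in> Zvec p n \<Longrightarrow> f x = (\<Sum>i<k. int p ^ i * a i x)"
  shows "gray_map p k n f \<in> GB p 1 (n + k - 1) \<and>
    (\<forall>u\<in>Zvec p n. \<forall>z\<in>Zvec p (k - 1). \<exists>c\<in>Zmod p.
      ((even n \<or> odd n \<and> [p = 1] (mod 4)) \<longrightarrow>
        walsh p (n + k - 1) (gray_map p k n f) (u @ z) \<in>
          {0, zeta p powi c * of_real (real p powr (real (k - 1) / 2)),
           - (zeta p powi c * of_real (real p powr (real (k - 1) / 2)))}) \<and>
      (odd n \<and> [p = 3] (mod 4) \<longrightarrow>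
        walsh p (n + k - 1) (gray_map p k n f) (u @ z) \<in>
          {0, \<i> * zeta p powi c * of_real (real p powr (real (k - 1) / 2)),
           - (\<i> * zeta p powi c * of_real (real p powr (real (k - 1) / 2)))}))"
proof (intro conjI ballI)
  have "p > 0"
    using assms(1) prime_gt_0_nat by blast
  then show "gray_map p k n f \<in> GB p 1 (n + k - 1)"
    by (auto simp: GB_def Zmod_def gray_map_def Let_def)
  fix u z assume u: "u \<in> Zvec p n" and z: "z \<in> Zvec p (k - 1)"
  obtain l where k: "k = Suc l"
    using assms(4) by (cases k) auto
  define \<eta> :: complex where "\<eta> = (if p mod 4 = 1 then 1 else \<i> ^ n)"
  define X where "X = walsh p (n + l) (gray_map p k n f) (u @ z)"
  obtain c where c: "c \<in> Zmod p"
    and X: "X \<in> {0, \<eta> * zeta p powi c * of_real (real p powr (real l / 2)),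
      - (\<eta> * zeta p powi c * of_real (real p powr (real l / 2)))}"
    using walsh_gray_map_values[of p l n f a u z] assms u z
    unfolding X_def \<eta>_def k by (auto simp: Pi_iff)
  have i_even: "(\<i> :: complex) ^ (2 * b) = 1 \<or> (\<i> :: complex) ^ (2 * b) = -1" for b
    by (cases "even b") (simp_all add: power_mult)
  have real: "\<eta> = 1 \<or> \<eta> = -1" if "even n \<or> odd n \<and> [p = 1] (mod 4)"
    using that i_even[of "n div 2"] by (auto simp: \<eta>_def cong_def)
  have imag: "\<eta> = \<i> \<or> \<eta> = - \<i>" if "odd n \<and> [p = 3] (mod 4)"
  proof -
    have "\<i> ^ n = (\<i> :: complex) * \<i> ^ (2 * (n div 2))"
      using that by (metis odd_two_times_div_two_succ power_Suc Suc_eq_plus1)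
    then show ?thesis
      using that i_even[of "n div 2"] by (auto simp: \<eta>_def cong_def)
  qed
  show "\<exists>c\<in>Zmod p.
      ((even n \<or> odd n \<and> [p = 1] (mod 4)) \<longrightarrow>
        walsh p (n + k - 1) (gray_map p k n f) (u @ z) \<in>
          {0, zeta p powi c * of_real (real p powr (real (k - 1) / 2)),
           - (zeta p powi c * of_real (real p powr (real (k - 1) / 2)))}) \<and>
      (odd n \<and> [p = 3] (mod 4) \<longrightarrow>
        walsh p (n + k - 1) (gray_map p k n f) (u @ z) \<in>
          {0, \<i> * zeta p powi c * of_real (real p powr (real (k - 1) / 2)),
           - (\<i> * zeta p powi c * of_real (real p powr (real (k - 1) / 2)))})"
  proof (rule bexI[OF _ c], intro conjI impI)
    assume "even n \<or> odd n \<and> [p = 1] (mod 4)"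
    then show "walsh p (n + k - 1) (gray_map p k n f) (u @ z) \<in>
        {0, zeta p powi c * of_real (real p powr (real (k - 1) / 2)),
         - (zeta p powi c * of_real (real p powr (real (k - 1) / 2)))}"
      using real X by (auto simp: X_def k)
  next
    assume "odd n \<and> [p = 3] (mod 4)"
    then show "walsh p (n + k - 1) (gray_map p k n f) (u @ z) \<in>
        {0, \<i> * zeta p powi c * of_real (real p powr (real (k - 1) / 2)),
         - (\<i> * zeta p powi c * of_real (real p powr (real (k - 1) / 2)))}"
      using imag X by (auto simp: X_def k)
  qed
qed

end
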